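(* The map sending $Q\in\mathcal{E}_\omega$ to the underlying unlabelled tree of $BT(Q)$ induces a bijection between $\mathcal{E}_\omega/{=_{\mathcal{B}}}$ and the set of all recursive trees; in particular, for every recursive tree $T$ there is a closed λ-term $\mathtt{J}_T\in\mathcal{E}_\omega$ whose Böhm tree has underlying tree $T$, and $T\neq T'$ implies $\mathcal{B}\nvdash\mathtt{J}_T=\mathtt{J}_{T'}$.
   Context: Böhm-like trees: coinductively generated by $U::=\bot\mid\lambda x_1\dots x_n.yU_1\cdots U_k$; Böhm trees $BT(M)$ as usual; $M=_\mathcal{B}N$ iff $BT(M)=BT(N)$. The relation $\le^\eta_\omega$ is the greatest relation on Böhm-like trees such that $U\le^\eta_\omega V$ implies either $U=V=\bot$, or $U=\lambda x_1\dots x_n.yU_1\cdots U_k$ and $V=\lambda x_1\dots x_nz_1\dots z_m.yV_1\cdots V_kV'_1\cdots V'_m$ with the $z_i$ not free in $yU_1\cdots U_kV_1\cdots V_k$, $U_j\le^\eta_\omega V_j$ for $j\le k$ and $z_i\le^\eta_\omega V'_i$ for $i\le m$. $\mathcal{E}_\omega$ is the set of λ-terms $Q$ with $BT(\lambda x.x)\le^\eta_\omega BT(Q)$ (η-expansions of the identity). An (unlabelled) tree is a partial function $T:\mathbb{N}^*\to\mathbb{N}$ with prefix-closed domain such that for $\sigma\in\mathrm{dom}(T)$, $\sigma.n\in\mathrm{dom}(T)\iff n<T(\sigma)$ ($T(\sigma)$ is the number of children); it is recursive if $T$ is partial recursive after an effective coding of $\mathbb{N}^*$. The underlying unlabelled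 tree of a Böhm-like tree has the same positions and child counts.
   Formalization: Trees are required to be nonempty (the root position belongs to the domain): the empty partial function literally satisfies the definition of a recursive tree but is not the underlying tree of any Böhm tree of a term in E_ω. *)

theory Defs
  imports Main "HOL-Library.Nat_Bijection"
begin

datatype dB = Var nat | App dB dB | Abs dB

primrec lift :: "dB \<Rightarrow> nat \<Rightarrow> dB" where
  "lift (Var i) k = (if i < k then Var i else Var (Suc i))"
| "lift (App s t) k = App (lift s k) (lift t k)"
| "lift (Abs s) k = Abs (lift s (Suc k))"

primrec subst :: "dB \<Rightarrow> dB \<Rightarrow> nat \<Rightarrow> dB" where
  "subst (Var i) s k = (if k < i then Var (i - 1) else if i = k then s else Var i)"
| "subst (App t u) s k = App (subst t s k) (subst u s k)"
| "subst (Abs t) s k = Abs (subst t (lift s 0) (Suc k))"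

inductive beta :: "dB \<Rightarrow> dB \<Rightarrow> bool" where
  beta_redex: "beta (App (Abs s) t) (subst s t 0)"
| appL: "beta s t \<Longrightarrow> beta (App s u) (App t u)"
| appR: "beta s t \<Longrightarrow> beta (App u s) (App u t)"
| abs: "beta s t \<Longrightarrow> beta (Abs s) (Abs t)"

abbreviation beta_reds :: "dB \<Rightarrow> dB \<Rightarrow> bool" where
  "beta_reds \<equiv> beta\<^sup>*\<^sup>*"

primrec closed_at :: "nat \<Rightarrow> dB \<Rightarrow> bool" where
  "closed_at k (Var i) = (i < k)"
| "closed_at k (App s t) = (closed_at k s \<and> closed_at k t)"
| "closed_at k (Abs s) = closed_at (Suc k) s"

definition closed :: "dB \<Rightarrow> bool" where
  "closed t = closed_at 0 t"

definition abss :: "nat \<Rightarrow> dB \<Rightarrow> dB" where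
  "abss n t = (Abs ^^ n) t"

definition apps :: "dB \<Rightarrow> dB list \<Rightarrow> dB" where
  "apps h ts = foldl App h ts"

definition has_hnf :: "dB \<Rightarrow> bool" where
  "has_hnf M \<longleftrightarrow> (\<exists>n y args. beta_reds M (abss n (apps (Var y) args)))"

definition hnf_of :: "dB \<Rightarrow> nat \<times> nat \<times> dB list" where
  "hnf_of M = (SOME (n, y, args). beta_reds M (abss n (apps (Var y) args)))"

text \<open>A Boehm-like tree is represented as a partial map from positions (paths from the root,
  child indices starting at 0) to labels \<open>(n, y, k)\<close> standing for a node
  \<open>\<lambda>x1..xn. y _ ... _\<close> with k children; the head variable y is a de Bruijn index relative to
  the binders on the path to the node including the n binders of the node itself.
  \<open>None\<close> at the root is \<open>\<bottom>\<close>; positions outside the tree are mapped to \<open>None\<close>.\<close>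

type_synonym btree = "nat list \<Rightarrow> (nat \<times> nat \<times> nat) option"

fun BT :: "dB \<Rightarrow> btree" where
  "BT M [] = (if has_hnf M then (case hnf_of M of (n, y, args) \<Rightarrow> Some (n, y, length args)) else None)"
| "BT M (i # \<sigma>) = (if has_hnf M then (case hnf_of M of (n, y, args) \<Rightarrow>
      if i < length args then BT (args ! i) \<sigma> else None) else None)"

definition beq :: "dB \<Rightarrow> dB \<Rightarrow> bool" (infix "=\<^sub>B" 50) where
  "M =\<^sub>B N \<longleftrightarrow> BT M = BT N"

definition bt_bot :: btree where
  "bt_bot = (\<lambda>_. None)"

definition bt_sub :: "btree \<Rightarrow> nat \<Rightarrow> btree" where
  "bt_sub T i = (\<lambda>\<sigma>. T (i # \<sigma>))"

definition var_tree :: "nat \<Rightarrow> btree" where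
  "var_tree x = (\<lambda>\<sigma>. if \<sigma> = [] then Some (0, x, 0) else None)"

fun bt_lift :: "nat \<Rightarrow> nat \<Rightarrow> btree \<Rightarrow> btree" where
  "bt_lift d c T [] = map_option (\<lambda>(n, y, k). (n, if c + n \<le> y then y + d else y, k)) (T [])"
| "bt_lift d c T (i # \<sigma>) = (case T [] of None \<Rightarrow> None
      | Some (n, y, k) \<Rightarrow> bt_lift d (c + n) (bt_sub T i) \<sigma>)"

fun bt_free_at :: "nat \<Rightarrow> btree \<Rightarrow> nat list \<Rightarrow> bool" where
  "bt_free_at x T [] = (case T [] of None \<Rightarrow> False | Some (n, y, k) \<Rightarrow> y = x + n)"
| "bt_free_at x T (i # \<sigma>) = (case T [] of None \<Rightarrow> False
      | Some (n, y, k) \<Rightarrow> bt_free_at (x + n) (bt_sub T i) \<sigma>)"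

definition bt_free :: "nat \<Rightarrow> btree \<Rightarrow> bool" where
  "bt_free x T \<longleftrightarrow> (\<exists>\<sigma>. bt_free_at x T \<sigma>)"

text \<open>The relation \<open>\<le>\<^sup>\<eta>\<^sub>\<omega>\<close> in de Bruijn form. In
  \<open>V = \<lambda>x1..xn z1..zm. y' V1 .. Vk V'1 .. V'm\<close> the z's are the innermost binders, so z_(i+1)
  has index \<open>m - 1 - i\<close> and the head y of U becomes \<open>y + m\<close>; the subtree \<open>U_j\<close> of U is compared
  with \<open>V_j\<close> after inserting the m new variables in its context.\<close>
coinductive eta_le :: "btree \<Rightarrow> btree \<Rightarrow> bool" where
  bot: "U = bt_bot \<Longrightarrow> V = bt_bot \<Longrightarrow> eta_le U V"
| node: "U [] = Some (n, y, k) \<Longrightarrow> V [] = Some (n + m, y + m, k + m) \<Longrightarrow>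
     (\<forall>j<k. \<forall>x<m. \<not> bt_free x (bt_sub V j)) \<Longrightarrow>
     (\<forall>j<k. eta_le (bt_lift m 0 (bt_sub U j)) (bt_sub V j)) \<Longrightarrow>
     (\<forall>i<m. eta_le (var_tree (m - 1 - i)) (bt_sub V (k + i))) \<Longrightarrow>
     eta_le U V"

definition E_omega :: "dB set" where
  "E_omega = {Q. eta_le (BT (Abs (Var 0))) (BT Q)}"

definition underlying_tree :: "btree \<Rightarrow> (nat list \<Rightarrow> nat option)" where
  "underlying_tree T = (\<lambda>\<sigma>. map_option (\<lambda>(n, y, k). k) (T \<sigma>))"

definition is_tree :: "(nat list \<Rightarrow> nat option) \<Rightarrow> bool" where
  "is_tree T \<longleftrightarrow> T [] \<noteq> None
     \<and> (\<forall>\<sigma> \<tau>. T (\<sigma> @ \<tau>) \<noteq> None \<longrightarrow> T \<sigma> \<noteq> None)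
     \<and> (\<forall>\<sigma> k. T \<sigma> = Some k \<longrightarrow> (\<forall>n. T (\<sigma> @ [n]) \<noteq> None \<longleftrightarrow> n < k))"

datatype recf = Zero | Succ | Proj nat | Comp recf "recf list" | Prim recf recf | Mn recf

inductive eval_recf :: "recf \<Rightarrow> nat list \<Rightarrow> nat \<Rightarrow> bool" where
  "eval_recf Zero xs 0"
| "eval_recf Succ (x # xs) (Suc x)"
| "i < length xs \<Longrightarrow> eval_recf (Proj i) xs (xs ! i)"
| "length ys = length gs \<Longrightarrow> (\<forall>i<length gs. eval_recf (gs ! i) xs (ys ! i)) \<Longrightarrow>
     eval_recf f ys z \<Longrightarrow> eval_recf (Comp f gs) xs z"
| "eval_recf f xs y \<Longrightarrow> eval_recf (Prim f g) (0 # xs) y"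
| "eval_recf (Prim f g) (n # xs) y \<Longrightarrow> eval_recf g (n # y # xs) z \<Longrightarrow>
     eval_recf (Prim f g) (Suc n # xs) z"
| "eval_recf f (n # xs) 0 \<Longrightarrow> (\<forall>i<n. \<exists>y. eval_recf f (i # xs) (Suc y)) \<Longrightarrow>
     eval_recf (Mn f) xs n"

definition partial_recursive :: "(nat \<Rightarrow> nat option) \<Rightarrow> bool" where
  "partial_recursive f \<longleftrightarrow> (\<exists>r. \<forall>x v. f x = Some v \<longleftrightarrow> eval_recf r [x] v)"

definition recursive_tree :: "(nat list \<Rightarrow> nat option) \<Rightarrow> bool" where
  "recursive_tree T \<longleftrightarrow> is_tree T \<and> partial_recursive (\<lambda>c. T (list_decode c))"

end

theory Submission
  imports Defs
begin

text \<open>By confluence the Boehm tree of a term is determined by any of its head normal forms. A tree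
  \<open>V\<close> with \<open>x \<le>\<^sup>\<eta>\<^sub>\<omega> V\<close> has a root \<open>\<lambda>z1..zm. x V1 .. Vm\<close> with \<open>z_i \<le>\<^sup>\<eta>\<^sub>\<omega> V_i\<close>, so all its labels can
  be reconstructed from the numbers of children; this gives injectivity. The number of children at
  a position of \<open>BT Q\<close> is the unique value for which a derivation in a finite system of rules
  (for lifting, substitution, reduction and the spine of head normal forms) exists, and an
  unbounded search for such a derivation is a partial recursive function. Conversely, programs are
  compiled to terms computing on Scott numerals, and a fixed point combinator yields a closed term
  \<open>N\<close> with \<open>N \<sigma> x = \<lambda>z1..zm. x (N \<sigma>.1 z1) .. (N \<sigma>.m zm)\<close> for \<open>m = T \<sigma>\<close>; then \<open>J\<close> is
  \<open>\<lambda>x. N \<epsilon> x\<close>. Only values on the domain of \<open>T\<close> matter here, so divergence of programs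
  need not be reflected.\<close>

section \<open>Confluence and Boehm trees\<close>

text \<open>The labels are recoverable because the coinductive comparison meets only leaves on its
  left: the identity at the root, single variables below.

  Having a head normal form is undecidable, so the number of children at a position can only be
  searched for. Stating lifting, substitution and reduction as rules instead of programming them
  keeps the arithmetisation small: a rule application is a set of equations between codes below
  existential quantifiers, and one general result on derivability performs the search.

  In the converse direction the obstacle is that the number of binders of a node is itself a
  computed value. A Scott numeral is its own case distinction and hands over its predecessor, so a
  loop can emit one abstraction per successor and collect the arguments in an accumulator, until
  zero releases the head normal form. Equations in the quotient by conversion carry the computation;
  only the emitted abstractions call for representatives and explicit lifting.\<close>

lemma lift_lift: "i \<le> k \<Longrightarrow> lift (lift t i) (Suc k) = lift (lift t k) i"
  by (induction t arbitrary: i k) auto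

lemma lift_subst: "j \<le> i \<Longrightarrow> lift (subst t s j) i = subst (lift t (Suc i)) (lift s i) j"
  by (induction t arbitrary: i j s) (auto simp: lift_lift diff_Suc split: nat.split)

lemma lift_subst_lt: "i \<le> j \<Longrightarrow> lift (subst t s j) i = subst (lift t i) (lift s i) (Suc j)"
  by (induction t arbitrary: i j s) (auto simp: lift_lift)

lemma subst_lift: "subst (lift t k) s k = t"
  by (induction t arbitrary: k s) auto

lemma subst_subst:
  "i \<le> j \<Longrightarrow> subst (subst t (lift v i) (Suc j)) (subst u v j) i = subst (subst t u i) v j"
  by (induction t arbitrary: i j u v)
    (auto simp: subst_lift lift_lift[symmetric] lift_subst_lt diff_Suc split: nat.split)

inductive par :: "dB \<Rightarrow> dB \<Rightarrow> bool" where
  par_Var [intro!]: "par (Var i) (Var i)"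
| par_App [intro]: "par s s' \<Longrightarrow> par t t' \<Longrightarrow> par (App s t) (App s' t')"
| par_Abs [intro!]: "par s s' \<Longrightarrow> par (Abs s) (Abs s')"
| par_beta [intro!]: "par s s' \<Longrightarrow> par t t' \<Longrightarrow> par (App (Abs s) t) (subst s' t' 0)"

inductive_cases par_AbsE: "par (Abs s) u"

lemma par_refl: "par t t"
  by (induction t) auto

lemma par_lift: "par s t \<Longrightarrow> par (lift s k) (lift t k)"
  by (induction arbitrary: k rule: par.induct) (auto simp: lift_subst)

lemma par_subst: "par s s' \<Longrightarrow> par t t' \<Longrightarrow> par (subst s t k) (subst s' t' k)"
proof (induction arbitrary: t t' k rule: par.induct)
  case (par_beta s s' u u')
  have "par (App (Abs (subst s (lift t 0) (Suc k))) (subst u t k))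
     (subst (subst s' (lift t' 0) (Suc k)) (subst u' t' k) 0)"
    by (intro par.par_beta par_beta par_lift)
  then show ?case by (simp add: subst_subst)
qed (auto simp: par_lift)

text \<open>Complete development in the sense of Takahashi: all redexes of the term are contracted at
  once, so every parallel step can be completed to it.\<close>

fun cd :: "dB \<Rightarrow> dB" where
  "cd (Var i) = Var i"
| "cd (App (Abs s) t) = subst (cd s) (cd t) 0"
| "cd (App s t) = App (cd s) (cd t)"
| "cd (Abs s) = Abs (cd s)"

lemma par_cd: "par s t \<Longrightarrow> par t (cd s)"
proof (induction rule: par.induct)
  case (par_App s s' t t')
  show ?case
  proof (cases "\<exists>u. s = Abs u")
    case True
    then obtain u where u: "s = Abs u" by blast
    with par_App obtain u' where "s' = Abs u'" "par u' (cd u)"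
      by (auto elim!: par_AbsE)
    with u par_App show ?thesis by auto
  next
    case False
    then have "cd (App s t) = App (cd s) (cd t)" by (cases s) auto
    with par_App show ?thesis by auto
  qed
qed (auto intro: par_subst)

lemma beta_imp_par: "beta s t \<Longrightarrow> par s t"
  by (induction rule: beta.induct) (auto intro: par_refl)

lemma reds_App: "beta_reds s s' \<Longrightarrow> beta_reds t t' \<Longrightarrow> beta_reds (App s t) (App s' t')"
proof -
  assume "beta_reds s s'" and t: "beta_reds t t'"
  then have "beta_reds (App s t) (App s' t)"
    by (induction rule: rtranclp_induct) (auto intro: rtranclp.rtrancl_into_rtrancl beta.appL)
  moreover from t have "beta_reds (App s' t) (App s' t')"
    by (induction rule: rtranclp_induct) (auto intro: rtranclp.rtrancl_into_rtrancl beta.appR)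
  ultimately show ?thesis by simp
qed

lemma reds_Abs: "beta_reds s s' \<Longrightarrow> beta_reds (Abs s) (Abs s')"
  by (induction rule: rtranclp_induct) (auto intro: rtranclp.rtrancl_into_rtrancl beta.abs)

lemma par_imp_reds: "par s t \<Longrightarrow> beta_reds s t"
proof (induction rule: par.induct)
  case (par_beta s s' t t')
  then have "beta_reds (App (Abs s) t) (App (Abs s') t')" by (intro reds_App reds_Abs)
  then show ?case by (rule rtranclp.rtrancl_into_rtrancl) (rule beta.beta_redex)
qed (auto intro: reds_App reds_Abs)

text \<open>The next step from \<open>t\<close> and the step from \<open>t\<close> to
  \<open>v\<close> are both completed at \<open>cd t\<close>.\<close>

lemma reds_strip: "par\<^sup>*\<^sup>* s t \<Longrightarrow> par s u \<Longrightarrow> \<exists>v. par t v \<and> par\<^sup>*\<^sup>* u v"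
proof (induction rule: rtranclp_induct)
  case (step t t')
  then obtain v where "par t v" "par\<^sup>*\<^sup>* u v" by blast
  with step.hyps(2) show ?case by (meson par_cd rtranclp.rtrancl_into_rtrancl)
qed blast

lemma par_confluent: "par\<^sup>*\<^sup>* s u \<Longrightarrow> par\<^sup>*\<^sup>* s t \<Longrightarrow> \<exists>v. par\<^sup>*\<^sup>* t v \<and> par\<^sup>*\<^sup>* u v"
proof (induction rule: rtranclp_induct)
  case (step u u')
  then obtain v where v: "par\<^sup>*\<^sup>* t v" "par\<^sup>*\<^sup>* u v" by blast
  from reds_strip[OF v(2) step.hyps(2)] obtain w where "par v w" "par\<^sup>*\<^sup>* u' w" by blast
  with v(1) show ?case by (meson rtranclp.rtrancl_into_rtrancl)
qed blast

lemma par_rtrancl_eq: "par\<^sup>*\<^sup>* = beta_reds"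
proof (intro ext iffI)
  show "beta_reds s t" if "par\<^sup>*\<^sup>* s t" for s t
    using that by (induction rule: rtranclp_induct) (auto dest: par_imp_reds)
  show "par\<^sup>*\<^sup>* s t" if "beta_reds s t" for s t
    using that by (induction rule: rtranclp_induct)
      (auto dest: beta_imp_par intro: rtranclp.rtrancl_into_rtrancl)
qed

lemma confluence: "beta_reds s t \<Longrightarrow> beta_reds s u \<Longrightarrow> \<exists>v. beta_reds t v \<and> beta_reds u v"
  using par_confluent[of s u t] unfolding par_rtrancl_eq by blast

section \<open>Head normal forms: shape, reducts and independence of the choice\<close>

lemma abss_simps [simp]: "abss 0 t = t" "abss (Suc n) t = Abs (abss n t)"
  by (simp_all add: abss_def)

lemma apps_simps [simp]: "apps h [] = h" "apps h (ts @ [t]) = App (apps h ts) t"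
  by (simp_all add: apps_def)

lemma apps_Var_eq_iff [simp]:
  "apps (Var y) as = apps (Var z) bs \<longleftrightarrow> y = z \<and> as = bs"
proof (induction as arbitrary: bs rule: rev_induct)
  case Nil
  then show ?case by (cases bs rule: rev_cases) auto
next
  case (snoc a as)
  then show ?case by (cases bs rule: rev_cases) auto
qed

lemma apps_Var_neq_Abs [simp]: "apps (Var y) as \<noteq> Abs t" "Abs t \<noteq> apps (Var y) as"
  by (cases as rule: rev_cases, auto)+

lemma hnf_eq_iff [simp]:
  "abss n (apps (Var y) as) = abss m (apps (Var z) bs) \<longleftrightarrow> n = m \<and> y = z \<and> as = bs"
proof (induction n arbitrary: m)
  case 0
  then show ?case by (cases m) auto
next
  case (Suc n)
  then show ?case by (cases m) auto
qed

inductive_cases beta_VarE: "beta (Var i) u"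
inductive_cases beta_AppE: "beta (App s t) u"
inductive_cases beta_AbsE: "beta (Abs s) u"

lemma beta_apps:
  "beta (apps (Var y) as) X \<Longrightarrow> \<exists>bs. X = apps (Var y) bs \<and> list_all2 beta_reds as bs"
proof (induction as arbitrary: X rule: rev_induct)
  case Nil
  then show ?case by (auto elim: beta_VarE)
next
  case (snoc a as)
  have refl: "list_all2 beta_reds as as" by (simp add: list_all2_refl)
  from snoc.prems show ?case unfolding apps_simps
  proof (rule beta_AppE)
    fix t assume "X = App t a" "beta (apps (Var y) as) t"
    with snoc.IH obtain bs where "X = apps (Var y) (bs @ [a])" "list_all2 beta_reds as bs"
      by fastforce
    then show ?thesis by (intro exI[of _ "bs @ [a]"]) (auto intro!: list_all2_appendI)
  next
    fix t assume "X = App (apps (Var y) as) t" "beta a t"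
    then show ?thesis using refl
      by (intro exI[of _ "as @ [t]"]) (auto intro!: list_all2_appendI)
  qed auto
qed

lemma beta_hnf:
  "beta (abss n (apps (Var y) as)) X
   \<Longrightarrow> \<exists>bs. X = abss n (apps (Var y) bs) \<and> list_all2 beta_reds as bs"
proof (induction n arbitrary: X)
  case 0
  then show ?case by (simp add: beta_apps)
next
  case (Suc n)
  then show ?case by (fastforce elim: beta_AbsE)
qed

lemma reds_hnf:
  "beta_reds (abss n (apps (Var y) as)) X
   \<Longrightarrow> \<exists>bs. X = abss n (apps (Var y) bs) \<and> list_all2 beta_reds as bs"
proof (induction rule: rtranclp_induct)
  case base
  show ?case by (intro exI[of _ as]) (simp add: list_all2_refl)
next
  case (step X Z)
  then obtain bs where bs: "X = abss n (apps (Var y) bs)" "list_all2 beta_reds as bs" by blast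
  with step.hyps(2) obtain cs where "Z = abss n (apps (Var y) cs)" "list_all2 beta_reds bs cs"
    using beta_hnf by blast
  with bs(2) show ?case
    by (blast intro: list_all2_trans[of beta_reds beta_reds beta_reds] rtranclp_trans)
qed

lemma hnf_of_reds:
  assumes "has_hnf M" "hnf_of M = (n, y, as)"
  shows "beta_reds M (abss n (apps (Var y) as))"
proof -
  let ?P = "\<lambda>(n, y, as). beta_reds M (abss n (apps (Var y) as))"
  from assms(1) have "\<exists>p. ?P p" unfolding has_hnf_def by fastforce
  then have "?P (hnf_of M)" unfolding hnf_of_def by (rule someI_ex)
  with assms(2) show ?thesis by simp
qed

text \<open>Reducts of a head normal form keep its binders and its head, so the two forms must agree
  there. The common reducts \<open>cs\<close> of the arguments let the comparison continue in the
  subtrees.\<close>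

lemma hnf_joinable:
  assumes "beta_reds M P" "beta_reds N P"
    "beta_reds M (abss n (apps (Var y) as))" "beta_reds N (abss m (apps (Var z) bs))"
  shows "n = m \<and> y = z \<and> (\<exists>cs. list_all2 beta_reds as cs \<and> list_all2 beta_reds bs cs)"
proof -
  from confluence[OF assms(1,3)] obtain Q
    where Q: "beta_reds P Q" "beta_reds (abss n (apps (Var y) as)) Q" by blast
  from confluence[OF rtranclp_trans[OF assms(2) Q(1)] assms(4)] obtain R
    where R: "beta_reds Q R" "beta_reds (abss m (apps (Var z) bs)) R" by blast
  with Q(2) have "beta_reds (abss n (apps (Var y) as)) R" by simp
  from reds_hnf[OF this] reds_hnf[OF R(2)] show ?thesis by auto
qed

lemma has_hnf_joinable:
  assumes "beta_reds M P" "beta_reds N P" "has_hnf M"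
  shows "has_hnf N"
proof -
  from assms(3) obtain n y as where "beta_reds M (abss n (apps (Var y) as))"
    by (auto simp: has_hnf_def)
  with assms(1) obtain Q where "beta_reds P Q" "beta_reds (abss n (apps (Var y) as)) Q"
    using confluence by blast
  with assms(2) reds_hnf show ?thesis unfolding has_hnf_def
    by (metis rtranclp_trans)
qed

text \<open>\<open>hnf_of\<close> is a Hilbert choice, so the arguments chosen for a term and for
  its reduct are merely joinable. Joinability, unlike reduction of one side to the other, passes to
  the children.\<close>

lemma BT_joinable: "beta_reds M P \<Longrightarrow> beta_reds N P \<Longrightarrow> BT M \<sigma> = BT N \<sigma>"
proof (induction \<sigma> arbitrary: M N P)
  case Nil
  show ?case
  proof (cases "has_hnf M")
    case True
    with Nil have N: "has_hnf N" by (metis has_hnf_joinable)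
    obtain n y as m z bs where *: "hnf_of M = (n, y, as)" "hnf_of N = (m, z, bs)"
      by (metis prod_cases3)
    from hnf_joinable[OF Nil hnf_of_reds[OF True *(1)] hnf_of_reds[OF N *(2)]]
    have "n = m" "y = z" "length as = length bs" by (auto dest!: list_all2_lengthD)
    with True N * show ?thesis by simp
  next
    case False
    with Nil have "\<not> has_hnf N" by (metis has_hnf_joinable)
    with False show ?thesis by simp
  qed
next
  case (Cons i \<sigma>)
  show ?case
  proof (cases "has_hnf M")
    case True
    with Cons.prems have N: "has_hnf N" by (metis has_hnf_joinable)
    obtain n y as m z bs where *: "hnf_of M = (n, y, as)" "hnf_of N = (m, z, bs)"
      by (metis prod_cases3)
    from hnf_joinable[OF Cons.prems hnf_of_reds[OF True *(1)] hnf_of_reds[OF N *(2)]]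
    obtain cs where cs: "list_all2 beta_reds as cs" "list_all2 beta_reds bs cs" by auto
    have "BT (as ! i) \<sigma> = BT (bs ! i) \<sigma>" if "i < length as"
      using that cs by (intro Cons.IH[of _ "cs ! i"]) (auto simp: list_all2_conv_all_nth)
    moreover from cs have "length as = length bs" by (metis list_all2_lengthD)
    ultimately show ?thesis using * True N by simp
  next
    case False
    with Cons.prems have "\<not> has_hnf N" by (metis has_hnf_joinable)
    with False show ?thesis by simp
  qed
qed

lemma BT_reds: "beta_reds M N \<Longrightarrow> BT M = BT N"
  by (intro ext BT_joinable) auto

lemma BT_hnf:
  "BT (abss n (apps (Var y) as)) [] = Some (n, y, length as)"
  "BT (abss n (apps (Var y) as)) (i # \<sigma>) = (if i < length as then BT (as ! i) \<sigma> else None)"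
proof -
  let ?M = "abss n (apps (Var y) as)"
  have hnf: "has_hnf ?M" unfolding has_hnf_def by blast
  obtain m z bs where h: "hnf_of ?M = (m, z, bs)" by (metis prod_cases3)
  from reds_hnf[OF hnf_of_reds[OF hnf h]]
  have *: "m = n" "z = y" "list_all2 beta_reds as bs" by auto
  with hnf h show "BT ?M [] = Some (n, y, length as)" by (auto dest: list_all2_lengthD)
  have "BT (bs ! i) = BT (as ! i)" if "i < length as"
    using that *(3) by (intro BT_reds[symmetric]) (auto simp: list_all2_conv_all_nth)
  with hnf h * show "BT ?M (i # \<sigma>) = (if i < length as then BT (as ! i) \<sigma> else None)"
    by (auto dest: list_all2_lengthD)
qed

declare BT.simps [simp del]

lemma BT_cases:
  obtains "BT M = bt_bot"
  | n y as where "beta_reds M (abss n (apps (Var y) as))" "BT M [] = Some (n, y, length as)"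
    "\<And>i. bt_sub (BT M) i = (if i < length as then BT (as ! i) else bt_bot)"
proof (cases "has_hnf M")
  case True
  then obtain n y as where r: "beta_reds M (abss n (apps (Var y) as))"
    by (auto simp: has_hnf_def)
  show thesis
  proof (rule that(2)[OF r])
    show "BT M [] = Some (n, y, length as)" 
      unfolding BT_reds[OF r] by (rule BT_hnf)
    show "bt_sub (BT M) i = (if i < length as then BT (as ! i) else bt_bot)" for i
      unfolding BT_reds[OF r] by (auto simp: bt_sub_def bt_bot_def BT_hnf)
  qed
next
  case False
  have "BT M \<sigma> = None" for \<sigma> using False by (cases \<sigma>) (auto simp: BT.simps)
  then show thesis by (intro that(1)) (auto simp: bt_bot_def)
qed

section \<open>Expansions of a variable\<close>

text \<open>\<open>eta_le\<close> constrains a map only at the children announced by its root. The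
  rest comes from terms: their subtrees are again Boehm trees, and nothing lies beyond the
  arity.\<close>

lemma BT_subtree:
  assumes "BT M [] = Some (n, y, k)"
  obtains as where "length as = k" "\<And>i. i < k \<Longrightarrow> bt_sub (BT M) i = BT (as ! i)"
    "\<And>i \<sigma>. BT M (i # \<sigma>) = (if i < k then BT (as ! i) \<sigma> else None)"
proof (rule BT_cases[of M])
  fix n' y' as
  assume "BT M [] = Some (n', y', length as)"
    and sub: "\<And>i. bt_sub (BT M) i = (if i < length as then BT (as ! i) else bt_bot)"
  with assms have "length as = k" by simp
  with sub show thesis
    by (intro that[of as]) (auto simp: bt_sub_def bt_bot_def fun_eq_iff split: if_splits)
qed (use assms in \<open>simp add: bt_bot_def\<close>)

text \<open>A leaf has \<open>k = 0\<close>, so every child of \<open>V\<close> expands one of the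
  \<open>m\<close> new variables and is compared with a leaf again. Given \<open>a\<close> and
  \<open>x\<close>, the number \<open>m\<close> alone fixes the root label.\<close>

lemma eta_le_leaf:
  assumes "eta_le U V" "U [] = Some (a, x, 0)"
  obtains m where "V [] = Some (a + m, x + m, m)"
    "\<And>i. i < m \<Longrightarrow> eta_le (var_tree (m - 1 - i)) (bt_sub V i)"
  using assms(1)
proof cases
  case bot
  with assms(2) show thesis by (simp add: bt_bot_def)
next
  case (node n y k m)
  with assms(2) show thesis by (intro that[of m]) auto
qed

lemma var_tree_root: "var_tree x [] = Some (0, x, 0)"
  by (simp add: var_tree_def)

lemma BT_id_root: "BT (Abs (Var 0)) [] = Some (1, 0, 0)"
  using BT_hnf(1)[of 1 0 "[]"] by simp

text \<open>The leaf \<open>U\<close> is arbitrary so that the induction can start at the identity,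
  with \<open>a = 1\<close>, and continue with variables, where \<open>a = 0\<close>. The underlying
  trees force the same \<open>m\<close> on both sides.\<close>

lemma eta_le_determined:
  assumes "eta_le U (BT M)" "eta_le U (BT N)" "U [] = Some (a, x, 0)"
    "underlying_tree (BT M) = underlying_tree (BT N)"
  shows "BT M \<sigma> = BT N \<sigma>"
  using assms
proof (induction \<sigma> arbitrary: U M N a x)
  case Nil
  obtain m where "BT M [] = Some (a + m, x + m, m)" using Nil eta_le_leaf by metis
  moreover obtain k where "BT N [] = Some (a + k, x + k, k)" using Nil eta_le_leaf by metis
  ultimately show ?case using fun_cong[OF Nil(4), of "[]"] by (simp add: underlying_tree_def)
next
  case (Cons i \<sigma>)
  obtain m where m: "BT M [] = Some (a + m, x + m, m)"
    "\<And>i. i < m \<Longrightarrow> eta_le (var_tree (m - 1 - i)) (bt_sub (BT M) i)"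
    using Cons.prems eta_le_leaf by metis
  obtain k where k: "BT N [] = Some (a + k, x + k, k)"
    "\<And>i. i < k \<Longrightarrow> eta_le (var_tree (k - 1 - i)) (bt_sub (BT N) i)"
    using Cons.prems eta_le_leaf by metis
  have [simp]: "k = m" using fun_cong[OF Cons.prems(4), of "[]"] m k
    by (simp add: underlying_tree_def)
  obtain as where as: "\<And>i. i < m \<Longrightarrow> bt_sub (BT M) i = BT (as ! i)"
    "\<And>i \<sigma>. BT M (i # \<sigma>) = (if i < m then BT (as ! i) \<sigma> else None)"
    using BT_subtree[OF m(1)] by metis
  obtain bs where bs: "\<And>i. i < m \<Longrightarrow> bt_sub (BT N) i = BT (bs ! i)"
    "\<And>i \<sigma>. BT N (i # \<sigma>) = (if i < m then BT (bs ! i) \<sigma> else None)"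
    using BT_subtree[OF k(1)] unfolding \<open>k = m\<close> by metis
  have "BT (as ! i) \<sigma> = BT (bs ! i) \<sigma>" if i: "i < m"
  proof (rule Cons.IH)
    show "var_tree (m - 1 - i) [] = Some (0, m - 1 - i, 0)" by (rule var_tree_root)
    show "eta_le (var_tree (m - 1 - i)) (BT (as ! i))" using m(2)[OF i] as(1)[OF i] by simp
    show "eta_le (var_tree (m - 1 - i)) (BT (bs ! i))" using k(2)[of i] bs(1)[OF i] i by simp
    show "underlying_tree (BT (as ! i)) = underlying_tree (BT (bs ! i))"
    proof
      fix \<tau>
      show "underlying_tree (BT (as ! i)) \<tau> = underlying_tree (BT (bs ! i)) \<tau>"
        using fun_cong[OF Cons.prems(4), of "i # \<tau>"] as(2) bs(2) i
        by (simp add: underlying_tree_def)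
    qed
  qed
  with as(2) bs(2) show ?case by simp
qed

lemma BT_prefix: "BT M (\<sigma> @ \<tau>) \<noteq> None \<Longrightarrow> BT M \<sigma> \<noteq> None"
proof (induction \<sigma> arbitrary: M)
  case Nil
  then show ?case by (cases rule: BT_cases[of M]) (auto simp: bt_bot_def)
next
  case (Cons i \<sigma>)
  show ?case
  proof (rule BT_cases[of M])
    fix n y as
    assume root: "BT M [] = Some (n, y, length as)"
    obtain bs where "\<And>j \<sigma>. BT M (j # \<sigma>) = (if j < length as then BT (bs ! j) \<sigma> else None)"
      using BT_subtree[OF root] by metis
    with Cons show ?thesis by (auto split: if_splits)
  qed (use Cons.prems in \<open>auto simp: bt_bot_def\<close>)
qed

text \<open>A leaf is never related to \<open>bt_bot\<close>, so each announced child is really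
  present.\<close>

lemma eta_le_children:
  assumes "eta_le U (BT M)" "U [] = Some (a, x, 0)" "BT M \<sigma> = Some (n, y, k)"
  shows "BT M (\<sigma> @ [i]) \<noteq> None \<longleftrightarrow> i < k"
  using assms
proof (induction \<sigma> arbitrary: U M a x)
  case Nil
  obtain m where m: "BT M [] = Some (a + m, x + m, m)"
    "\<And>i. i < m \<Longrightarrow> eta_le (var_tree (m - 1 - i)) (bt_sub (BT M) i)"
    using Nil eta_le_leaf by metis
  obtain as where as: "\<And>i. i < m \<Longrightarrow> bt_sub (BT M) i = BT (as ! i)"
    "\<And>i \<sigma>. BT M (i # \<sigma>) = (if i < m then BT (as ! i) \<sigma> else None)"
    using BT_subtree[OF m(1)] by metis
  have "BT (as ! i) [] \<noteq> None" if "i < m"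
    using eta_le_leaf[OF m(2)[OF that] var_tree_root] as(1)[OF that] by (metis option.simps(3))
  with as(2) m(1) Nil show ?case by auto
next
  case (Cons j \<sigma>)
  obtain m where m: "BT M [] = Some (a + m, x + m, m)"
    "\<And>i. i < m \<Longrightarrow> eta_le (var_tree (m - 1 - i)) (bt_sub (BT M) i)"
    using Cons.prems eta_le_leaf by metis
  obtain as where as: "\<And>i. i < m \<Longrightarrow> bt_sub (BT M) i = BT (as ! i)"
    "\<And>i \<sigma>. BT M (i # \<sigma>) = (if i < m then BT (as ! i) \<sigma> else None)"
    using BT_subtree[OF m(1)] by metis
  from Cons.prems(3) as(2) have "j < m" "BT (as ! j) \<sigma> = Some (n, y, k)"
    by (auto split: if_splits)
  moreover from this m(2) as(1) have "eta_le (var_tree (m - 1 - j)) (BT (as ! j))" by metis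
  ultimately have "BT (as ! j) (\<sigma> @ [i]) \<noteq> None \<longleftrightarrow> i < k"
    using Cons.IH var_tree_root by blast
  with as(2) \<open>j < m\<close> show ?case by simp
qed

lemma is_tree_eta:
  assumes "eta_le U (BT M)" "U [] = Some (a, x, 0)"
  shows "is_tree (underlying_tree (BT M))"
  unfolding is_tree_def
proof (intro conjI allI impI)
  show "underlying_tree (BT M) [] \<noteq> None"
    using eta_le_leaf[OF assms]
      by (metis (no_types, lifting) option.map_disc_iff option.simps(3) underlying_tree_def)
  fix \<sigma> \<tau> assume "underlying_tree (BT M) (\<sigma> @ \<tau>) \<noteq> None"
  then show "underlying_tree (BT M) \<sigma> \<noteq> None"
    using BT_prefix[of M \<sigma> \<tau>] by (simp add: underlying_tree_def)
next
  fix \<sigma> k i assume "underlying_tree (BT M) \<sigma> = Some k"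
  then obtain n y where "BT M \<sigma> = Some (n, y, k)" by (auto simp: underlying_tree_def)
  from eta_le_children[OF assms this]
  show "underlying_tree (BT M) (\<sigma> @ [i]) \<noteq> None \<longleftrightarrow> i < k" by (simp add: underlying_tree_def)
qed

section \<open>Terms modulo conversion and Scott numerals\<close>

text \<open>Joinability is beta conversion, and confluence makes it transitive. In the quotient,
  equations between programs become rewrite rules; abstraction stays with representatives, through
  \<open>cl_Abs_cong\<close>.\<close>

definition conv :: "dB \<Rightarrow> dB \<Rightarrow> bool" where
  "conv s t \<longleftrightarrow> (\<exists>u. beta_reds s u \<and> beta_reds t u)"

lemma conv_beta: "conv (App (Abs s) t) (subst s t 0)"
  unfolding conv_def by (blast intro: beta.beta_redex)

lemma conv_App: "conv s s' \<Longrightarrow> conv t t' \<Longrightarrow> conv (App s t) (App s' t')"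
  unfolding conv_def by (blast intro: reds_App)

lemma conv_Abs: "conv s s' \<Longrightarrow> conv (Abs s) (Abs s')"
  unfolding conv_def by (blast intro: reds_Abs)

quotient_type lam = dB / conv
proof (rule equivpI)
  show "reflp conv" by (auto simp: reflp_def conv_def)
  show "symp conv" by (auto simp: symp_def conv_def)
  show "transp conv"
  proof (rule transpI)
    fix s t u assume "conv s t" "conv t u"
    then obtain v w where vw: "beta_reds s v" "beta_reds t v" "beta_reds t w" "beta_reds u w"
      by (auto simp: conv_def)
    with confluence obtain z where "beta_reds v z" "beta_reds w z" by blast
    with vw show "conv s u" unfolding conv_def by (meson rtranclp_trans)
  qed
qed

lift_definition cl :: "dB \<Rightarrow> lam" is "\<lambda>t. t" .

lift_definition lapp :: "lam \<Rightarrow> lam \<Rightarrow> lam" (infixl "\<cdot>" 70) is App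
  by (rule conv_App)

lemma cl_App [simp]: "cl (App s t) = cl s \<cdot> cl t"
  by transfer (simp add: conv_def; blast)

lemma cl_beta [simp]: "cl (Abs s) \<cdot> cl t = cl (subst s t 0)"
  by transfer (rule conv_beta)

lemma cl_Abs_cong: "cl s = cl t \<Longrightarrow> cl (Abs s) = cl (Abs t)"
  by transfer (rule conv_Abs)

lemma cl_surj: obtains t where "a = cl t"
  by transfer (auto simp: conv_def)

lemma BT_cl: "cl s = cl t \<Longrightarrow> BT s = BT t"
  by transfer (metis BT_reds conv_def)

lemma closed_at_lift: "closed_at k t \<Longrightarrow> k \<le> i \<Longrightarrow> lift t i = t"
  by (induction t arbitrary: k i) auto

lemma closed_at_subst: "closed_at k t \<Longrightarrow> k \<le> i \<Longrightarrow> subst t s i = t"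
  by (induction t arbitrary: k i s) auto

lemma closed_at_mono: "closed_at k t \<Longrightarrow> k \<le> i \<Longrightarrow> closed_at i t"
  by (induction t arbitrary: k i) auto

lemma closed_simps [simp]:
  "closed t \<Longrightarrow> lift t i = t"
  "closed t \<Longrightarrow> subst t s i = t"
  "closed t \<Longrightarrow> closed_at i t"
  by (auto simp: closed_def closed_at_lift closed_at_subst intro: closed_at_mono)

lemma closed_App [simp]: "closed (App s t) \<longleftrightarrow> closed s \<and> closed t"
  by (simp add: closed_def)

lemmas subst_lift_simps = subst_lift lift_subst_lt[symmetric]

text \<open>Turing's fixed point combinator.\<close>

definition fixT :: dB where
  "fixT = (let a = Abs (Abs (App (Var 0) (App (App (Var 1) (Var 1)) (Var 0)))) in App a a)"

lemma closed_fixT [simp]: "closed fixT"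
  by (simp add: fixT_def closed_def Let_def)

lemma fixT_unfold: "cl fixT \<cdot> a = a \<cdot> (cl fixT \<cdot> a)"
proof -
  let ?a = "Abs (Abs (App (Var 0) (App (App (Var 1) (Var 1)) (Var 0))))"
  obtain t where a: "a = cl t" by (rule cl_surj)
  have "cl ?a \<cdot> cl ?a \<cdot> cl t = cl t \<cdot> (cl ?a \<cdot> cl ?a \<cdot> cl t)"
    by (subst (1) cl_beta) (simp del: cl_beta, subst (1) cl_beta, simp del: cl_beta)
  with a show ?thesis by (simp add: fixT_def Let_def del: cl_beta)
qed

text \<open>Scott numerals: the second branch receives the predecessor. Being closed,
  \<open>num n\<close> stands unlifted below the binders.\<close>

primrec num :: "nat \<Rightarrow> dB" where
  "num 0 = Abs (Abs (Var 1))"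
| "num (Suc n) = Abs (Abs (App (Var 0) (num n)))"

definition sucT :: dB where
  "sucT = Abs (Abs (Abs (App (Var 0) (Var 2))))"

text \<open>Scott lists, the branch for cons coming last; the empty list is
  \<open>num 0\<close>.\<close>

definition consT :: dB where
  "consT = Abs (Abs (Abs (Abs (App (App (Var 0) (Var 3)) (Var 2)))))"

lemma closed_num [simp]: "closed (num n)"
proof (induction n)
  case (Suc n)
  then have "closed_at (Suc (Suc 0)) (num n)" by simp
  then show ?case by (simp add: closed_def)
qed (simp add: closed_def)

lemma closed_consts [simp]: "closed sucT" "closed consT"
  by (simp_all add: closed_def sucT_def consT_def)

lemma num_0_app: "cl (num 0) \<cdot> a \<cdot> b = a"
  by (cases rule: cl_surj[of a]; cases rule: cl_surj[of b]) (simp add: subst_lift_simps)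

lemma num_Suc_app: "cl (num (Suc n)) \<cdot> a \<cdot> b = b \<cdot> cl (num n)"
  by (cases rule: cl_surj[of a]; cases rule: cl_surj[of b]) (simp add: subst_lift_simps)

lemma sucT_num: "cl sucT \<cdot> cl (num n) = cl (num (Suc n))"
  by (simp add: sucT_def)

lemma consT_app: "cl consT \<cdot> a \<cdot> l \<cdot> b \<cdot> c = c \<cdot> a \<cdot> l"
  by (cases rule: cl_surj[of a]; cases rule: cl_surj[of b]; cases rule: cl_surj[of c];
      cases rule: cl_surj[of l]) (simp add: consT_def subst_lift_simps)

section \<open>Compiling recursive functions to terms\<close>

lemma closed_Abs [simp]: "closed (Abs t) \<longleftrightarrow> closed_at (Suc 0) t"
  by (simp add: closed_def)

definition listT :: "dB list \<Rightarrow> dB" where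
  "listT ts = foldr (\<lambda>t l. App (App consT t) l) ts (num 0)"

lemma listT_simps [simp]: "listT [] = num 0" "listT (t # ts) = App (App consT t) (listT ts)"
  by (simp_all add: listT_def)

lemma subst_listT: "subst (listT ts) u k = listT (map (\<lambda>t. subst t u k) ts)"
  by (induction ts) simp_all

lemma closed_at_listT: "closed_at k (listT ts) \<longleftrightarrow> (\<forall>t\<in>set ts. closed_at k t)"
  by (induction ts) simp_all

text \<open>The auxiliary terms are supercombinators: each of them is closed and is given all the
  variables it needs as arguments, so that the equations below hold for arbitrary elements of
  \<^typ>\<open>lam\<close> and never mention a binder.\<close>

definition succ1T :: dB where
  "succ1T = Abs (Abs (App sucT (Var 1)))"

definition tail_caseT :: "dB \<Rightarrow> dB" where
  "tail_caseT p = Abs (Abs (App p (Var 0)))"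

text \<open>\<open>num 0\<close> is also the combinator K: as the branch for cons it returns the
  head of the list, as the branch for nil it is a mere default.\<close>

primrec projT :: "nat \<Rightarrow> dB" where
  "projT 0 = Abs (App (App (Var 0) (num 0)) (num 0))"
| "projT (Suc i) = Abs (App (App (Var 0) (num 0)) (tail_caseT (projT i)))"

text \<open>The arguments are the recursive function, the parameters and the predecessor, which is
  last because the numeral supplies it.\<close>

definition prim_succT :: "dB \<Rightarrow> dB" where
  "prim_succT g = Abs (Abs (Abs (App g (App (App consT (Var 0)) (App (App consT
     (App (Var 2) (App (App consT (Var 0)) (Var 1)))) (Var 1))))))"

definition prim_caseT :: "dB \<Rightarrow> dB \<Rightarrow> dB" where
  "prim_caseT f g = Abs (Abs (Abs (App (App (Var 1) (App f (Var 0)))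
     (App (App (prim_succT g) (Var 2)) (Var 0)))))"

definition primT :: "dB \<Rightarrow> dB \<Rightarrow> dB" where
  "primT f g = App fixT (Abs (Abs (App (App (Var 0) (num 0)) (App (prim_caseT f g) (Var 1)))))"

text \<open>The fourth argument is the predecessor handed over by a nonzero value of the tested
  function; it is dropped and the next candidate is tried.\<close>

definition mn_nextT :: dB where
  "mn_nextT = Abs (Abs (Abs (Abs (App (App (Var 3) (Var 2)) (App sucT (Var 1))))))"

definition mnT :: "dB \<Rightarrow> dB" where
  "mnT f = App fixT (Abs (Abs (Abs (App (App (App f (App (App consT (Var 0)) (Var 1))) (Var 0))
     (App (App (App mn_nextT (Var 2)) (Var 1)) (Var 0))))))"

primrec recT :: "recf \<Rightarrow> dB" where
  "recT Zero = Abs (num 0)"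
| "recT Succ = Abs (App (App (Var 0) (num 0)) succ1T)"
| "recT (Proj i) = projT i"
| "recT (Comp f gs) = Abs (App (recT f) (listT (map (\<lambda>t. App t (Var 0)) (map recT gs))))"
| "recT (Prim f g) = primT (recT f) (recT g)"
| "recT (Mn f) = Abs (App (App (mnT (recT f)) (Var 0)) (num 0))"

lemma closed_supers [simp]:
  "closed succ1T" "closed mn_nextT"
  "closed p \<Longrightarrow> closed (tail_caseT p)"
  "closed g \<Longrightarrow> closed (prim_succT g)"
  "closed f \<Longrightarrow> closed g \<Longrightarrow> closed (prim_caseT f g)"
  "closed f \<Longrightarrow> closed g \<Longrightarrow> closed (primT f g)"
  "closed f \<Longrightarrow> closed (mnT f)"
  by (simp_all add: succ1T_def tail_caseT_def prim_succT_def prim_caseT_def primT_def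
      mn_nextT_def mnT_def)

lemma closed_projT [simp]: "closed (projT i)"
  by (induction i) simp_all

lemma closed_recT [simp]: "closed (recT r)"
  by (induction r) (simp_all add: closed_at_listT)

lemma succ1T_app: "cl succ1T \<cdot> a \<cdot> b = cl sucT \<cdot> a"
  by (cases rule: cl_surj[of a]; cases rule: cl_surj[of b])
    (simp add: succ1T_def subst_lift_simps)

lemma tail_caseT_app: "closed p \<Longrightarrow> cl (tail_caseT p) \<cdot> a \<cdot> b = cl p \<cdot> b"
  by (cases rule: cl_surj[of a]; cases rule: cl_surj[of b])
    (simp add: tail_caseT_def subst_lift_simps)

lemma prim_succT_app:
  "closed g \<Longrightarrow> cl (prim_succT g) \<cdot> p \<cdot> xs \<cdot> n =
     cl g \<cdot> (cl consT \<cdot> n \<cdot> (cl consT \<cdot> (p \<cdot> (cl consT \<cdot> n \<cdot> xs)) \<cdot> xs))"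
  by (cases rule: cl_surj[of p]; cases rule: cl_surj[of xs]; cases rule: cl_surj[of n])
    (simp add: prim_succT_def subst_lift_simps)

lemma prim_caseT_app:
  "closed f \<Longrightarrow> closed g \<Longrightarrow> cl (prim_caseT f g) \<cdot> p \<cdot> n \<cdot> xs =
     n \<cdot> (cl f \<cdot> xs) \<cdot> (cl (prim_succT g) \<cdot> p \<cdot> xs)"
  by (cases rule: cl_surj[of p]; cases rule: cl_surj[of xs]; cases rule: cl_surj[of n])
    (simp add: prim_caseT_def subst_lift_simps)

lemma primT_app:
  assumes "closed f" "closed g"
  shows "cl (primT f g) \<cdot> l = l \<cdot> cl (num 0) \<cdot> (cl (prim_caseT f g) \<cdot> cl (primT f g))"
proof -
  let ?F = "Abs (Abs (App (App (Var 0) (num 0)) (App (prim_caseT f g) (Var 1))))"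
  have "cl ?F \<cdot> p \<cdot> l = l \<cdot> cl (num 0) \<cdot> (cl (prim_caseT f g) \<cdot> p)" for p
    using assms by (cases rule: cl_surj[of p]; cases rule: cl_surj[of l])
      (simp add: subst_lift_simps)
  \<comment> \<open>A single unfolding: as a rewrite rule the fixed point equation would
    loop.\<close>
  then show ?thesis unfolding primT_def cl_App by (subst fixT_unfold) 
qed

lemma mn_nextT_app: "cl mn_nextT \<cdot> m \<cdot> l \<cdot> n \<cdot> b = m \<cdot> l \<cdot> (cl sucT \<cdot> n)"
  by (cases rule: cl_surj[of m]; cases rule: cl_surj[of l]; cases rule: cl_surj[of n];
      cases rule: cl_surj[of b]) (simp add: mn_nextT_def subst_lift_simps)

lemma mnT_app:
  assumes "closed f"
  shows "cl (mnT f) \<cdot> l \<cdot> n = cl f \<cdot> (cl consT \<cdot> n \<cdot> l) \<cdot> n \<cdot> (cl mn_nextT \<cdot> cl (mnT f) \<cdot> l \<cdot> n)"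
proof -
  let ?F = "Abs (Abs (Abs (App (App (App f (App (App consT (Var 0)) (Var 1))) (Var 0))
     (App (App (App mn_nextT (Var 2)) (Var 1)) (Var 0)))))"
  have "cl ?F \<cdot> m \<cdot> l \<cdot> n = cl f \<cdot> (cl consT \<cdot> n \<cdot> l) \<cdot> n \<cdot> (cl mn_nextT \<cdot> m \<cdot> l \<cdot> n)" for m
    using assms by (cases rule: cl_surj[of m]; cases rule: cl_surj[of l]; cases rule: cl_surj[of n])
      (simp add: subst_lift_simps)
  then show ?thesis unfolding mnT_def cl_App by (subst fixT_unfold) 
qed

abbreviation numlist :: "nat list \<Rightarrow> lam" where
  "numlist xs \<equiv> cl (listT (map num xs))"

declare num.simps [simp del]

lemmas lam_simps = num_0_app num_Suc_app sucT_num consT_app succ1T_app tail_caseT_app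
  prim_succT_app prim_caseT_app mn_nextT_app

lemma projT_app:
  "cl (projT 0) \<cdot> l = l \<cdot> cl (num 0) \<cdot> cl (num 0)"
  "cl (projT (Suc i)) \<cdot> l = l \<cdot> cl (num 0) \<cdot> cl (tail_caseT (projT i))"
  by (cases rule: cl_surj[of l], simp)+

lemma projT_correct: "i < length xs \<Longrightarrow> cl (projT i) \<cdot> numlist xs = cl (num (xs ! i))"
proof (induction i arbitrary: xs)
  case 0
  then obtain x ys where "xs = x # ys" by (cases xs) auto
  then show ?case by (simp add: projT_app lam_simps del: projT.simps)
next
  case (Suc i)
  then obtain x ys where "xs = x # ys" by (cases xs) auto
  with Suc show ?case by (simp add: projT_app lam_simps del: projT.simps)
qed

lemma recT_Comp_app:
  "cl (recT (Comp f gs)) \<cdot> l = cl (recT f) \<cdot>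
    foldr (\<lambda>g m. cl consT \<cdot> (cl (recT g) \<cdot> l) \<cdot> m) gs (cl (num 0))"
proof -
  obtain t where l: "l = cl t" by (rule cl_surj)
  have "cl (listT (map (\<lambda>g. App (recT g) t) gs))
     = foldr (\<lambda>g m. cl consT \<cdot> (cl (recT g) \<cdot> l) \<cdot> m) gs (cl (num 0))"
    by (induction gs) (simp_all add: l)
  then show ?thesis by (simp add: l subst_listT o_def)
qed

lemma recT_correct: "eval_recf r xs y \<Longrightarrow> cl (recT r) \<cdot> numlist xs = cl (num y)"
proof (induction rule: eval_recf.induct)
  case (1 xs)
  obtain t where "numlist xs = cl t" by (rule cl_surj)
  then show ?case by simp
next
  case (2 x xs)
  obtain t where t: "numlist (x # xs) = cl t" by (rule cl_surj)
  have "cl (recT Succ) \<cdot> cl t = cl t \<cdot> cl (num 0) \<cdot> cl succ1T" by simp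
  then show ?case unfolding t[symmetric] by (simp add: lam_simps)
next
  case (3 i xs)
  then show ?case by (simp add: projT_correct)
next
  case (4 ys gs xs f z)
  have "foldr (\<lambda>g m. cl consT \<cdot> (cl (recT g) \<cdot> numlist xs) \<cdot> m) gs (cl (num 0)) = numlist ys"
  proof -
    have "length ys = length gs"
      "\<forall>i<length gs. cl (recT (gs ! i)) \<cdot> numlist xs = cl (num (ys ! i))" using 4 by blast+
    then show ?thesis
    proof (induction gs arbitrary: ys)
      case (Cons g gs)
      then obtain y zs where ys: "ys = y # zs" by (cases ys) auto
      have "cl (recT g) \<cdot> numlist xs = cl (num y)" using Cons.prems ys by force
      moreover have "foldr (\<lambda>g m. cl consT \<cdot> (cl (recT g) \<cdot> numlist xs) \<cdot> m) gs (cl (num 0)) =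
        numlist zs"
        using Cons.prems ys by (intro Cons.IH) auto
      ultimately show ?case using ys by simp
    qed simp
  qed
  with 4 show ?case by (simp only: recT_Comp_app)
next
  case (5 f xs y g)
  then show ?case by (simp add: primT_app lam_simps)
next
  case (6 f g n xs y z)
  \<comment> \<open>Only the outer call is unfolded; the recursive call on \<open>n\<close> is left
    for the induction hypothesis.\<close>
  then show ?case
    by (simp add: primT_app[of "recT f" "recT g" "cl consT \<cdot> cl (num (Suc n)) \<cdot> numlist xs"]
      lam_simps)
next
  case (7 f n xs)
  let ?m = "cl (mnT (recT f)) \<cdot> numlist xs"
  \<comment> \<open>Downward induction from the result: below \<open>n\<close> the tested value is a
    successor, so the loop moves from \<open>i\<close> to \<open>Suc i\<close>.\<close>
  have "i \<le> n \<Longrightarrow> ?m \<cdot> cl (num i) = cl (num n)" for i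
  proof (induction rule: inc_induct)
    case base
    show ?case using 7(2) by (subst mnT_app) (simp_all add: lam_simps)
  next
    case (step i)
    with 7(3) obtain y where "cl (recT f) \<cdot> numlist (i # xs) = cl (num (Suc y))" by blast
    with step.IH show ?case by (subst mnT_app) (simp_all add: lam_simps)
  qed
  then have "?m \<cdot> cl (num 0) = cl (num n)" by blast
  moreover obtain t where "numlist xs = cl t" by (rule cl_surj)
  ultimately show ?case by simp
qed

section \<open>The expansion with a given underlying tree\<close>

text \<open>A node \<open>\<sigma>\<close> of the tree is passed around as a closed term \<open>g\<close> mapping the code of a position
  \<open>\<tau>\<close> to the code of \<open>\<sigma> @ \<tau>\<close>: going to the \<open>i\<close>-th child then is a precomposition with the list
  constructor, for which \<open>s\<close> is a program.\<close>

definition childT :: "recf \<Rightarrow> dB" where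
  "childT s = Abs (Abs (Abs (App (Var 2)
     (App (recT s) (App (App consT (Var 1)) (App (App consT (Var 0)) (num 0)))))))"

text \<open>The variables, from the outside: the loop, the node function, the position, the child
  index, the head applied to the arguments so far, the number of children left, and the emitted
  binder \<open>z\<close>. The count comes after the other inputs because the Scott numeral supplies
  it.\<close>

definition layer_sucT :: "recf \<Rightarrow> dB" where
  "layer_sucT s = Abs (Abs (Abs (Abs (Abs (Abs (Abs
     (App (App (App (App (App (Var 6) (Var 5)) (Var 4)) (Var 1)) (App sucT (Var 3)))
       (App (Var 2) (App (App (Var 5) (App (App (childT s) (Var 4)) (Var 3))) (Var 0))))))))))"

definition layerT :: "recf \<Rightarrow> dB" where
  "layerT s = App fixT (Abs (Abs (Abs (Abs (Abs (Abs (App (App (Var 2) (Var 0))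
     (App (App (App (App (App (layer_sucT s) (Var 5)) (Var 4)) (Var 3)) (Var 1)) (Var 0)))))))))"

definition nodeT :: "recf \<Rightarrow> recf \<Rightarrow> dB" where
  "nodeT s r = App fixT (Abs (Abs (Abs (App (App (App (App (App (layerT s) (Var 2)) (Var 1))
     (App (recT r) (App (App consT (App (Var 1) (num 0))) (num 0)))) (num 0)) (Var 0)))))"

definition expansionT :: "recf \<Rightarrow> recf \<Rightarrow> dB" where
  "expansionT s r = Abs (App (App (nodeT s r) (Abs (Var 0))) (Var 0))"

lemma closed_expansions [simp]:
  "closed (childT s)" "closed (layer_sucT s)" "closed (layerT s)" "closed (nodeT s r)"
  "closed (expansionT s r)"
  by (simp_all add: childT_def layer_sucT_def layerT_def nodeT_def expansionT_def)

lemma childT_app: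
  "cl (childT s) \<cdot> g \<cdot> i \<cdot> c = g \<cdot> (cl (recT s) \<cdot> (cl consT \<cdot> i \<cdot> (cl consT \<cdot> c \<cdot> cl (num 0))))"
  by (cases rule: cl_surj[of g]; cases rule: cl_surj[of i]; cases rule: cl_surj[of c])
    (simp add: childT_def subst_lift_simps)

text \<open>The binder \<open>z\<close> remains in the result, so representatives replace elements
  of \<open>lam\<close>: closed terms cross the binder unchanged, while the accumulator
  \<open>a\<close> may be open and is lifted.\<close>

lemma layer_sucT_app:
  assumes "closed l" "closed j" "closed g" "closed i" "closed m"
  shows "cl (layer_sucT s) \<cdot> cl l \<cdot> cl j \<cdot> cl g \<cdot> cl i \<cdot> cl a \<cdot> cl m =
    cl (Abs (App (App (App (App (App l j) g) m) (App sucT i))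
       (App (lift a 0) (App (App j (App (App (childT s) g) i)) (Var 0)))))"
  using assms lift_lift[of 0 0 a, symmetric] by (simp add: layer_sucT_def subst_lift_simps)

lemma layerT_app:
  "cl (layerT s) \<cdot> j \<cdot> g \<cdot> m \<cdot> i \<cdot> a =
     m \<cdot> a \<cdot> (cl (layer_sucT s) \<cdot> cl (layerT s) \<cdot> j \<cdot> g \<cdot> i \<cdot> a)"
proof -
  let ?F = "Abs (Abs (Abs (Abs (Abs (Abs (App (App (Var 2) (Var 0))
     (App (App (App (App (App (layer_sucT s) (Var 5)) (Var 4)) (Var 3)) (Var 1)) (Var 0))))))))"
  have "cl ?F \<cdot> l \<cdot> j \<cdot> g \<cdot> m \<cdot> i \<cdot> a = m \<cdot> a \<cdot> (cl (layer_sucT s) \<cdot> l \<cdot> j \<cdot> g \<cdot> i \<cdot> a)" for l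
    by (cases rule: cl_surj[of l]; cases rule: cl_surj[of j]; cases rule: cl_surj[of g];
        cases rule: cl_surj[of m]; cases rule: cl_surj[of i]; cases rule: cl_surj[of a])
      (simp add: subst_lift_simps)
  then show ?thesis unfolding layerT_def cl_App by (subst fixT_unfold)
qed

lemma nodeT_app:
  "cl (nodeT s r) \<cdot> g \<cdot> x = cl (layerT s) \<cdot> cl (nodeT s r) \<cdot> g
     \<cdot> (cl (recT r) \<cdot> (cl consT \<cdot> (g \<cdot> cl (num 0)) \<cdot> cl (num 0))) \<cdot> cl (num 0) \<cdot> x"
proof -
  let ?F = "Abs (Abs (Abs (App (App (App (App (App (layerT s) (Var 2)) (Var 1))
     (App (recT r) (App (App consT (App (Var 1) (num 0))) (num 0)))) (num 0)) (Var 0))))"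
  have "cl ?F \<cdot> j \<cdot> g \<cdot> x = cl (layerT s) \<cdot> j \<cdot> g
     \<cdot> (cl (recT r) \<cdot> (cl consT \<cdot> (g \<cdot> cl (num 0)) \<cdot> cl (num 0))) \<cdot> cl (num 0) \<cdot> x" for j
    by (cases rule: cl_surj[of j]; cases rule: cl_surj[of g]; cases rule: cl_surj[of x])
      (simp add: subst_lift_simps)
  then show ?thesis unfolding nodeT_def cl_App by (subst fixT_unfold)
qed

lemma apps_Cons: "apps (App h t) ts = apps h (t # ts)"
  by (simp add: apps_def)

lemma lifts_Var: "((\<lambda>t. lift t 0) ^^ m) (Var x) = Var (x + m)"
  by (induction m) simp_all

lemma lifts_App: "((\<lambda>t. lift t 0) ^^ m) (App t u)
  = App (((\<lambda>t. lift t 0) ^^ m) t) (((\<lambda>t. lift t 0) ^^ m) u)"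
  by (induction m) simp_all

lemma lifts_closed: "closed t \<Longrightarrow> ((\<lambda>t. lift t 0) ^^ m) t = t"
  by (induction m) simp_all

text \<open>The accumulator \<open>a\<close> and the index \<open>i\<close> vary in the induction.
  Every later binder shifts what was collected before, so argument \<open>k\<close> ends with the
  variable \<open>m - 1 - k\<close> and the head is lifted \<open>m\<close> times.\<close>

lemma layerT_num:
  assumes "closed j" "closed g"
  shows "cl (layerT s) \<cdot> cl j \<cdot> cl g \<cdot> cl (num m) \<cdot> cl (num i) \<cdot> cl a =
    cl (abss m (apps (((\<lambda>t. lift t 0) ^^ m) a)
      (map (\<lambda>k. App (App j (App (App (childT s) g) (num (i + k)))) (Var (m - 1 - k))) [0..<m])))"
proof (induction m arbitrary: i a)
  case 0
  then show ?case by (simp add: layerT_app num_0_app)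
next
  case (Suc m)
  let ?c = "\<lambda>i. App j (App (App (childT s) g) (num i))"
  let ?a = "App (lift a 0) (App (?c i) (Var 0))"
  let ?as = "map (\<lambda>k. App (?c (Suc i + k)) (Var (m - 1 - k))) [0..<m]"
  have "cl (layerT s) \<cdot> cl j \<cdot> cl g \<cdot> cl (num (Suc m)) \<cdot> cl (num i) \<cdot> cl a =
    cl (Abs (App (App (App (App (App (layerT s) j) g) (num m)) (App sucT (num i))) ?a))"
    using assms by (simp add: layerT_app num_Suc_app layer_sucT_app)
  also have "\<dots> = cl (Abs (abss m (apps (((\<lambda>t. lift t 0) ^^ m) ?a) ?as)))"
    by (rule cl_Abs_cong) (use Suc.IH[of "Suc i" ?a] in \<open>simp add: sucT_num\<close>)
  also have "apps (((\<lambda>t. lift t 0) ^^ m) ?a) ?as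
      = apps (((\<lambda>t. lift t 0) ^^ Suc m) a) (App (?c i) (Var m) # ?as)"
    unfolding lifts_App apps_Cons funpow_Suc_right o_def
    using assms by (simp add: lifts_App lifts_closed lifts_Var)
  also have "App (?c i) (Var m) # ?as
      = map (\<lambda>k. App (?c (i + k)) (Var (Suc m - 1 - k))) [0..<Suc m]"
    by (simp add: upt_conv_Cons map_Suc_upt[symmetric] del: upt_Suc)
  finally show ?case by simp
qed

definition position_term :: "nat list \<Rightarrow> dB \<Rightarrow> bool" where
  "position_term \<sigma> g \<longleftrightarrow> closed g \<and>
     (\<forall>c. cl g \<cdot> cl (num c) = cl (num (list_encode (\<sigma> @ list_decode c))))"

lemma position_term_Nil: "position_term [] (Abs (Var 0))"
  by (simp add: position_term_def)

text \<open>\<open>Suc (prod_encode (x, y))\<close> is the \<open>list_encode\<close> code of the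
  list with head \<open>x\<close> and tail coded by \<open>y\<close>.\<close>

lemma position_term_child:
  assumes s: "\<And>x y. eval_recf s [x, y] (Suc (prod_encode (x, y)))" and g: "position_term \<sigma> g"
  shows "position_term (\<sigma> @ [i]) (App (App (childT s) g) (num i))"
proof -
  have "cl (childT s) \<cdot> cl g \<cdot> cl (num i) \<cdot> cl (num c)
     = cl (num (list_encode (\<sigma> @ i # list_decode c)))" for c
    using recT_correct[OF s[of i c]] g by (simp add: childT_app position_term_def)
  with g show ?thesis by (simp add: position_term_def)
qed

lemma nodeT_hnf:
  assumes g: "position_term \<sigma> g" and r: "eval_recf r [list_encode \<sigma>] m"
  shows "cl (App (App (nodeT s r) g) (Var x)) = cl (abss m (apps (Var (x + m))
    (map (\<lambda>k. App (App (nodeT s r) (App (App (childT s) g) (num k))) (Var (m - 1 - k))) [0..<m])))"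
proof -
  \<comment> \<open>0 codes the empty list, so \<open>g\<close> yields the code of its own
    position.\<close>
  from g have "cl g \<cdot> cl (num 0) = cl (num (list_encode \<sigma>))" by (simp add: position_term_def)
  then have "cl (App (App (nodeT s r) g) (Var x)) =
      cl (layerT s) \<cdot> cl (nodeT s r) \<cdot> cl g \<cdot> cl (num m) \<cdot> cl (num 0) \<cdot> cl (Var x)"
    using recT_correct[OF r] by (simp add: nodeT_app)
  with layerT_num[of "nodeT s r" g s m 0 "Var x"] g show ?thesis
    by (simp add: position_term_def lifts_Var)
qed

context
  fixes T :: "nat list \<Rightarrow> nat option" and r s :: recf
  assumes tree: "is_tree T"
    and r: "\<And>\<sigma> m. T \<sigma> = Some m \<longleftrightarrow> eval_recf r [list_encode \<sigma>] m"
    and s: "\<And>x y. eval_recf s [x, y] (Suc (prod_encode (x, y)))"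
begin

lemma nodeT_BT:
  assumes g: "position_term \<sigma> g" and m: "T \<sigma> = Some m"
  shows "BT (App (App (nodeT s r) g) (Var x)) [] = Some (m, x + m, m)"
    "BT (App (App (nodeT s r) g) (Var x)) (i # \<tau>) = (if i < m
      then BT (App (App (nodeT s r) (App (App (childT s) g) (num i))) (Var (m - 1 - i))) \<tau>
        else None)"
  unfolding BT_cl[OF nodeT_hnf[OF g m[unfolded r]]] BT_hnf by simp_all

lemma child_in_tree: "T \<sigma> = Some m \<Longrightarrow> T (\<sigma> @ [i]) \<noteq> None \<longleftrightarrow> i < m"
  using tree by (simp add: is_tree_def)

lemma nodeT_eta_le:
  assumes "position_term \<sigma> g" "T \<sigma> = Some m"
  shows "eta_le (var_tree x) (BT (App (App (nodeT s r) g) (Var x)))"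
proof -
  \<comment> \<open>Closed under subtrees: child \<open>i\<close> is the node term for
    \<open>\<sigma> @ [i]\<close> applied to its own variable, and this position lies in the domain
    of \<open>T\<close>.\<close>
  define R where "R U V \<longleftrightarrow> (\<exists>\<sigma> g m x. position_term \<sigma> g \<and> T \<sigma> = Some m \<and> U = var_tree x
    \<and> V = BT (App (App (nodeT s r) g) (Var x)))" for U V
  have "R (var_tree x) (BT (App (App (nodeT s r) g) (Var x)))"
    using assms unfolding R_def by blast
  then show ?thesis
  proof (coinduct rule: eta_le.coinduct)
    case (eta_le U V)
    then obtain \<sigma> g m x where *: "position_term \<sigma> g" "T \<sigma> = Some m"
      and U: "U = var_tree x" and V: "V = BT (App (App (nodeT s r) g) (Var x))"
      unfolding R_def by blast
    have "R (var_tree (m - 1 - i)) (bt_sub V i)" if "i < m" for i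
    proof -
      from that child_in_tree[OF *(2)] obtain k where "T (\<sigma> @ [i]) = Some k" by blast
      moreover have "bt_sub V i
          = BT (App (App (nodeT s r) (App (App (childT s) g) (num i))) (Var (m - 1 - i)))"
        using that by (intro ext) (simp add: V bt_sub_def nodeT_BT[OF *])
      ultimately show ?thesis
        unfolding R_def using position_term_child[OF s *(1)] by blast
    qed
    then show ?case using var_tree_root[of x] nodeT_BT(1)[OF *, of x] U V
      by (intro disjI2 exI[of _ 0] exI[of _ x] exI[of _ m]) fastforce
  qed
qed

lemma nodeT_underlying:
  assumes "position_term \<sigma> g" "T \<sigma> = Some m"
  shows "underlying_tree (BT (App (App (nodeT s r) g) (Var x))) \<tau> = T (\<sigma> @ \<tau>)"
  using assms
proof (induction \<tau> arbitrary: \<sigma> g m x)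
  case Nil
  then show ?case by (simp add: underlying_tree_def nodeT_BT)
next
  case (Cons i \<tau>)
  show ?case
  proof (cases "i < m")
    case True
    with child_in_tree[OF Cons.prems(2)] obtain k where "T (\<sigma> @ [i]) = Some k" by blast
    with Cons.IH[OF position_term_child[OF s Cons.prems(1)]] True Cons.prems show ?thesis
      by (simp add: underlying_tree_def nodeT_BT)
  next
    case False
    with child_in_tree[OF Cons.prems(2)] have "T (\<sigma> @ [i]) = None" by blast
    with tree have "T ((\<sigma> @ [i]) @ \<tau>) = None" unfolding is_tree_def by metis
    with False Cons.prems show ?thesis by (simp add: underlying_tree_def nodeT_BT)
  qed
qed

text \<open>The root is treated by hand, since the identity has a binder of its own and the
  expansion thus has \<open>Suc m\<close> of them; the children are those of the node term for the
  empty position.\<close>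

lemma expansionT_correct:
  "eta_le (BT (Abs (Var 0))) (BT (expansionT s r))"
  "underlying_tree (BT (expansionT s r)) = T"
proof -
  let ?I = "Abs (Var 0)" and ?J = "expansionT s r"
  let ?N = "App (App (nodeT s r) ?I) (Var 0)"
  let ?c = "\<lambda>i. App (App (childT s) ?I) (num i)"
  from tree obtain m where m: "T [] = Some m" by (auto simp: is_tree_def)
  let ?as = "map (\<lambda>k. App (App (nodeT s r) (?c k)) (Var (m - 1 - k))) [0..<m]"
  note pos = position_term_Nil
  have "cl ?J = cl (Abs (abss m (apps (Var (0 + m)) ?as)))"
    unfolding expansionT_def using nodeT_hnf[OF pos m[unfolded r]] by (rule cl_Abs_cong)
  then have J: "cl ?J = cl (abss (Suc m) (apps (Var m) ?as))" by simp
  note BT_J = BT_cl[OF J]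
  have sub: "bt_sub (BT ?J) i = BT (App (App (nodeT s r) (?c i)) (Var (m - 1 - i)))"
    if "i < m" for i
    using that by (intro ext) (simp add: BT_J bt_sub_def BT_hnf del: abss_simps)
  show "eta_le (BT ?I) (BT ?J)"
  proof (rule eta_le.node[where m = m])
    show "BT ?J [] = Some (1 + m, 0 + m, 0 + m)" by (simp add: BT_J BT_hnf del: abss_simps)
    show "\<forall>i<m. eta_le (var_tree (m - 1 - i)) (bt_sub (BT ?J) (0 + i))"
    proof (intro allI impI)
      fix i assume "i < m"
      with child_in_tree[OF m] obtain k where "T ([] @ [i]) = Some k" by blast
      with sub[OF \<open>i < m\<close>] nodeT_eta_le[OF position_term_child[OF s pos]]
      show "eta_le (var_tree (m - 1 - i)) (bt_sub (BT ?J) (0 + i))" by simp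
    qed
  qed (simp_all add: BT_id_root)
  show "underlying_tree (BT ?J) = T"
  proof
    fix \<tau>
    have "underlying_tree (BT ?J) \<tau> = underlying_tree (BT ?N) \<tau>"
      by (cases \<tau>) (simp_all add: underlying_tree_def BT_J BT_hnf nodeT_BT[OF pos m]
        del: abss_simps)
    then show "underlying_tree (BT ?J) \<tau> = T \<tau>" using nodeT_underlying[OF pos m] by simp
  qed
qed

end

section \<open>Computable functions and semidecidable predicates\<close>

abbreviation pair :: "nat \<Rightarrow> nat \<Rightarrow> nat" where
  "pair x y \<equiv> prod_encode (x, y)"

abbreviation p1 :: "nat \<Rightarrow> nat" where
  "p1 x \<equiv> fst (prod_decode x)"

abbreviation p2 :: "nat \<Rightarrow> nat" where
  "p2 x \<equiv> snd (prod_decode x)"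

inductive_cases eval_ZeroE: "eval_recf Zero xs y"
inductive_cases eval_SuccE: "eval_recf Succ xs y"
inductive_cases eval_ProjE: "eval_recf (Proj i) xs y"
inductive_cases eval_CompE: "eval_recf (Comp f gs) xs y"
inductive_cases eval_Prim0E: "eval_recf (Prim f g) (0 # xs) y"
inductive_cases eval_PrimSE: "eval_recf (Prim f g) (Suc n # xs) y"
inductive_cases eval_MnE: "eval_recf (Mn f) xs y"

lemma eval_recf_determ: "eval_recf r xs y \<Longrightarrow> eval_recf r xs z \<Longrightarrow> y = z"
proof (induction arbitrary: z rule: eval_recf.induct)
  case (4 ys gs xs f z)
  from 4(5) obtain ys' where ys': "length ys' = length gs"
    "\<forall>i<length gs. eval_recf (gs ! i) xs (ys' ! i)" "eval_recf f ys' z"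
    by (auto elim: eval_CompE)
  have "ys = ys'" using 4 ys' by (intro nth_equalityI) auto
  with 4 ys' show ?case by auto
next
  case (6 f g n xs y z)
  from 6(5) show ?case by (rule eval_PrimSE) (use 6 in blast)
next
  case (7 f n xs)
  from 7(4) obtain m where "z = m" and m: "eval_recf f (m # xs) 0"
    "\<forall>i<m. \<exists>y. eval_recf f (i # xs) (Suc y)" by (auto elim: eval_MnE)
  have "\<not> n < m" using 7(2) m(2) by (metis nat.distinct(1))
  moreover have "\<not> m < n" using 7(3) m(1) by (metis nat.distinct(1))
  ultimately show ?case using \<open>z = m\<close> by simp
next
  case (1 xs)
  then show ?case by (rule eval_ZeroE) simp
next
  case (2 x xs)
  then show ?case by (rule eval_SuccE) simp
next
  case (3 i xs)
  from 3(2) show ?case by (rule eval_ProjE) simp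
next
  case (5 f xs y g)
  from 5(3) show ?case by (rule eval_Prim0E) (use 5 in blast)
qed

lemma eval_Comp1: "eval_recf g xs y \<Longrightarrow> eval_recf f [y] z \<Longrightarrow> eval_recf (Comp f [g]) xs z"
  by (rule eval_recf.intros(4)[of "[y]"]) auto

lemma eval_Comp2:
  "eval_recf g xs y \<Longrightarrow> eval_recf h xs y' \<Longrightarrow> eval_recf f [y, y'] z
   \<Longrightarrow> eval_recf (Comp f [g, h]) xs z"
  by (rule eval_recf.intros(4)[of "[y, y']"]) (auto simp: less_Suc_eq)

lemma eval_Proj: "i < length xs \<Longrightarrow> y = xs ! i \<Longrightarrow> eval_recf (Proj i) xs y"
  by (simp add: eval_recf.intros)

text \<open>With several arguments packed by \<open>pair\<close>, closure properties of unary
  functions are plain introduction rules. The binary variant serves to construct the pairing and to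
  feed minimisation.\<close>

definition computable :: "(nat \<Rightarrow> nat) \<Rightarrow> bool" where
  "computable f \<longleftrightarrow> (\<exists>r. \<forall>x. eval_recf r [x] (f x))"

definition computable2 :: "(nat \<Rightarrow> nat \<Rightarrow> nat) \<Rightarrow> bool" where
  "computable2 f \<longleftrightarrow> (\<exists>r. \<forall>x y. eval_recf r [x, y] (f x y))"

lemma computable_id: "computable (\<lambda>x. x)"
  unfolding computable_def by (rule exI[of _ "Proj 0"]) (simp add: eval_Proj)

lemma computable2_fst: "computable2 (\<lambda>x y. x)"
  unfolding computable2_def by (rule exI[of _ "Proj 0"]) (simp add: eval_Proj)

lemma computable2_snd: "computable2 (\<lambda>x y. y)"
  unfolding computable2_def by (rule exI[of _ "Proj 1"]) (simp add: eval_Proj)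

lemma computable_comp: "computable f \<Longrightarrow> computable g \<Longrightarrow> computable (\<lambda>x. f (g x))"
  unfolding computable_def by (meson eval_Comp1)

lemma computable2_comp: "computable f \<Longrightarrow> computable2 g \<Longrightarrow> computable2 (\<lambda>x y. f (g x y))"
  unfolding computable_def computable2_def by (meson eval_Comp1)

lemma computable_comp2: "computable2 f \<Longrightarrow> computable g \<Longrightarrow> computable h
  \<Longrightarrow> computable (\<lambda>x. f (g x) (h x))"
  unfolding computable_def computable2_def by (meson eval_Comp2)

lemma computable2_comp2: "computable2 f \<Longrightarrow> computable2 g \<Longrightarrow> computable2 h
  \<Longrightarrow> computable2 (\<lambda>x y. f (g x y) (h x y))"
  unfolding computable2_def by (meson eval_Comp2)

lemma computable_Suc: "computable f \<Longrightarrow> computable (\<lambda>x. Suc (f x))"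
  unfolding computable_def by (meson eval_Comp1 eval_recf.intros(2))

lemma computable_const: "computable (\<lambda>x. c)"
proof (induction c)
  case 0
  show ?case unfolding computable_def by (meson eval_recf.intros(1))
qed (rule computable_Suc)

lemma computable2_add: "computable2 (+)"
proof -
  have "eval_recf (Prim (Proj 0) (Comp Succ [Proj 1])) [n, m] (n + m)" for n m
  proof (induction n)
    case (Suc n)
    then show ?case
      by (auto intro!: eval_recf.intros(6)[of _ _ n] eval_Comp1[of _ _ "n + m"]
        eval_Proj eval_recf.intros(2))
  qed (auto intro!: eval_recf.intros(5) eval_Proj)
  then show ?thesis unfolding computable2_def by blast
qed

lemma computable_pred: "computable (\<lambda>x. x - 1)"
proof -
  have "eval_recf (Prim Zero (Proj 0)) [n] (n - 1)" for n
  proof (induction n)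
    case (Suc n)
    then show ?case by (auto intro!: eval_recf.intros(6)[of _ _ n] eval_Proj)
  qed (auto intro!: eval_recf.intros(5) eval_recf.intros(1))
  then show ?thesis unfolding computable_def by blast
qed

lemma computable2_diff: "computable2 (-)"
proof -
  obtain p where p: "\<And>x. eval_recf p [x] (x - 1)" using computable_pred
    unfolding computable_def by blast
  have "eval_recf (Prim (Proj 0) (Comp p [Proj 1])) [n, m] (m - n)" for n m
  proof (induction n)
    case (Suc n)
    have "eval_recf (Comp p [Proj 1]) [n, m - n, m] (m - n - 1)"
      by (rule eval_Comp1[OF _ p]) (simp add: eval_Proj)
    with Suc show ?case by (auto intro: eval_recf.intros(6))
  qed (auto intro!: eval_recf.intros(5) eval_Proj)
  then have "computable2 (\<lambda>n m. m - n)" unfolding computable2_def by blast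
  from computable2_comp2[OF this computable2_snd computable2_fst] show ?thesis .
qed

lemma computable_triangle: "computable triangle"
proof -
  obtain a where a: "\<And>x y. eval_recf a [x, y] (x + y)" using computable2_add
    unfolding computable2_def by blast
  have "eval_recf (Prim Zero (Comp Succ [a])) [n] (triangle n)" for n
  proof (induction n)
    case (Suc n)
    have "eval_recf (Comp Succ [a]) [n, triangle n] (Suc (n + triangle n))"
      by (rule eval_Comp1[OF a]) (rule eval_recf.intros(2))
    with Suc show ?case by (auto intro: eval_recf.intros(6) simp: add.commute)
  qed (auto intro!: eval_recf.intros(5) eval_recf.intros(1))
  then show ?thesis unfolding computable_def by blast
qed

lemma computable2_pair: "computable2 pair"
  unfolding prod_encode_def split
  by (intro computable2_comp2[OF computable2_add] computable2_comp[OF computable_triangle]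
    computable2_fst computable2_add)

section \<open>Minimisation and the inverse of pairing\<close>

lemma computable_Least:
  assumes "computable2 h" "\<And>x. \<exists>n. h n x = 0"
  shows "computable (\<lambda>x. LEAST n. h n x = 0)"
proof -
  obtain r where r: "\<And>n x. eval_recf r [n, x] (h n x)" using assms(1)
    unfolding computable2_def by blast
  have "eval_recf (Mn r) [x] (LEAST n. h n x = 0)" for x
  proof (rule eval_recf.intros(7))
    have "h (LEAST n. h n x = 0) x = 0" using assms(2) by (rule LeastI_ex)
    then show "eval_recf r [LEAST n. h n x = 0, x] 0" using r by metis
    show "\<forall>i<LEAST n. h n x = 0. \<exists>y. eval_recf r [i, x] (Suc y)"
      using r not_less_Least by (metis not0_implies_Suc)
  qed
  then show ?thesis unfolding computable_def by blast
qed

text \<open>Cantor pairing sends \<open>(m, n)\<close> to \<open>triangle (m + n) + m\<close>. The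
  diagonal \<open>m + n\<close> of \<open>x\<close> is the first \<open>k\<close> with
  \<open>x < triangle (Suc k)\<close>, written as a vanishing truncated difference because
  minimisation looks for zeros.\<close>

definition diagonal :: "nat \<Rightarrow> nat" where
  "diagonal x = (LEAST k. Suc x - triangle (Suc k) = 0)"

lemma triangle_mono: "m \<le> n \<Longrightarrow> triangle m \<le> triangle n"
  by (induction rule: dec_induct) simp_all

lemma le_triangle: "n \<le> triangle n"
  by (induction n) simp_all

lemma computable_diagonal: "computable diagonal"
proof -
  have "computable (\<lambda>k. triangle (Suc k))"
    by (rule computable_comp[OF computable_triangle computable_Suc[OF computable_id]])
  from computable2_comp2[OF computable2_diff computable2_comp
    [OF computable_Suc[OF computable_id] computable2_snd] computable2_comp[OF this computable2_fst]]
  have "computable2 (\<lambda>k x. Suc x - triangle (Suc k))" .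
  moreover have "\<exists>k. Suc x - triangle (Suc k) = 0" for x
    using le_triangle[of "Suc x"] by (intro exI[of _ x]) (simp only: diff_is_0_eq)
  ultimately show ?thesis unfolding diagonal_def by (rule computable_Least)
qed

lemma diagonal_pair: "diagonal (pair m n) = m + n"
  unfolding diagonal_def
proof (rule Least_equality)
  fix k assume k: "Suc (pair m n) - triangle (Suc k) = 0"
  show "m + n \<le> k"
  proof (rule ccontr)
    assume "\<not> m + n \<le> k"
    then have "triangle (Suc k) \<le> triangle (m + n)" by (intro triangle_mono) simp
    with k show False by (simp add: prod_encode_def del: triangle_Suc)
  qed
qed (simp add: prod_encode_def)

lemma p_diagonal: "p1 x = x - triangle (diagonal x)" "p2 x = diagonal x - p1 x"
proof -
  obtain m n where x: "x = pair m n" by (metis prod_decode_inverse surj_pair)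
  show "p1 x = x - triangle (diagonal x)" by (simp add: x diagonal_pair) (simp add: prod_encode_def)
  show "p2 x = diagonal x - p1 x" by (simp add: x diagonal_pair)
qed

lemma computable_add: "computable f \<Longrightarrow> computable g \<Longrightarrow> computable (\<lambda>x. f x + g x)"
  by (rule computable_comp2[OF computable2_add])

lemma computable_diff: "computable f \<Longrightarrow> computable g \<Longrightarrow> computable (\<lambda>x. f x - g x)"
  by (rule computable_comp2[OF computable2_diff])

lemma computable_pair: "computable f \<Longrightarrow> computable g \<Longrightarrow> computable (\<lambda>x. pair (f x) (g x))"
  by (rule computable_comp2[OF computable2_pair])

lemma computable_p1: "computable f \<Longrightarrow> computable (\<lambda>x. p1 (f x))"
  unfolding p_diagonal(1)
  by (rule computable_diff computable_comp[OF computable_triangle]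
    computable_comp[OF computable_diagonal] | assumption)+

lemma computable_p2: "computable f \<Longrightarrow> computable (\<lambda>x. p2 (f x))"
  unfolding p_diagonal(2)
  by (rule computable_diff computable_p1 computable_comp[OF computable_diagonal] | assumption)+

lemmas computable_intros = computable_id computable_const computable_Suc
  computable_add computable_diff computable_pair computable_p1 computable_p2

lemma computable_rec:
  assumes b: "computable b" and g: "computable g" and c: "computable c"
  shows "computable (\<lambda>x. rec_nat (b x) (\<lambda>n y. g (pair n (pair y x))) (c x))"
proof -
  obtain rb rg where rb: "\<And>x. eval_recf rb [x] (b x)" and rg: "\<And>x. eval_recf rg [x] (g x)"
    using b g unfolding computable_def by blast
  obtain rp where rp: "\<And>x y. eval_recf rp [x, y] (pair x y)" using computable2_pair
    unfolding computable2_def by blast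
  let ?r = "Prim rb (Comp rg [Comp rp [Proj 0, Comp rp [Proj 1, Proj 2]]])"
  have "eval_recf ?r [n, x] (rec_nat (b x) (\<lambda>n y. g (pair n (pair y x))) n)" for n x
  proof (induction n)
    case (Suc n)
    let ?y = "rec_nat (b x) (\<lambda>n y. g (pair n (pair y x))) n"
    have "eval_recf (Comp rp [Proj 1, Proj 2]) [n, ?y, x] (pair ?y x)"
      by (rule eval_Comp2[OF _ _ rp]) (simp_all add: eval_Proj)
    then have "eval_recf (Comp rp [Proj 0, Comp rp [Proj 1, Proj 2]]) [n, ?y, x]
      (pair n (pair ?y x))"
      by (intro eval_Comp2[OF _ _ rp]) (simp_all add: eval_Proj)
    from eval_recf.intros(6)[OF Suc eval_Comp1[OF this rg]] show ?case by simp
  qed (simp add: eval_recf.intros(5) rb)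
  then have "computable2 (\<lambda>n x. rec_nat (b x) (\<lambda>n y. g (pair n (pair y x))) n)"
    unfolding computable2_def by blast
  from computable_comp2[OF this c computable_id] show ?thesis .
qed

text \<open>Truth is 0, so minimisation searches for truth, a conjunction is a vanishing sum, and a
  bounded universal quantifier is a vanishing iterated sum.\<close>

definition decidable :: "(nat \<Rightarrow> bool) \<Rightarrow> bool" where
  "decidable P \<longleftrightarrow> computable (\<lambda>x. if P x then 0 else 1)"

lemma decidable_zero: "computable f \<Longrightarrow> decidable (\<lambda>x. f x = 0)"
proof -
  assume "computable f"
  then have "computable (\<lambda>x. 1 - (1 - f x))" by (intro computable_intros)
  moreover have "(\<lambda>x. 1 - (1 - f x)) = (\<lambda>x. if f x = 0 then 0 else 1)" by auto
  ultimately show ?thesis by (simp add: decidable_def)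
qed

lemma decidable_comp: "decidable P \<Longrightarrow> computable f \<Longrightarrow> decidable (\<lambda>x. P (f x))"
  unfolding decidable_def by (rule computable_comp)

lemma decidable_not: "decidable P \<Longrightarrow> decidable (\<lambda>x. \<not> P x)"
proof -
  assume "decidable P"
  then have "decidable (\<lambda>x. 1 - (if P x then 0 else 1 :: nat) = 0)"
    unfolding decidable_def[of P] by (intro decidable_zero computable_intros)
  moreover have "(\<lambda>x. 1 - (if P x then 0 else 1 :: nat) = 0) = (\<lambda>x. \<not> P x)" by auto
  ultimately show ?thesis by simp
qed

lemma decidable_conj: "decidable P \<Longrightarrow> decidable Q \<Longrightarrow> decidable (\<lambda>x. P x \<and> Q x)"
proof -
  assume "decidable P" "decidable Q"
  then have "decidable (\<lambda>x. (if P x then 0 else 1 :: nat) + (if Q x then 0 else 1) = 0)"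
    unfolding decidable_def[of P] decidable_def[of Q] by (intro decidable_zero computable_intros)
  moreover have "(\<lambda>x. (if P x then 0 else 1 :: nat) + (if Q x then 0 else 1) = 0) = (\<lambda>x. P x \<and> Q x)"
    by auto
  ultimately show ?thesis by simp
qed

lemma decidable_disj: "decidable P \<Longrightarrow> decidable Q \<Longrightarrow> decidable (\<lambda>x. P x \<or> Q x)"
  using decidable_not[OF decidable_conj[OF decidable_not decidable_not]] by fastforce

lemma decidable_le: "computable f \<Longrightarrow> computable g \<Longrightarrow> decidable (\<lambda>x. f x \<le> g x)"
  using decidable_zero[OF computable_diff, of f g] by simp

lemma decidable_less: "computable f \<Longrightarrow> computable g \<Longrightarrow> decidable (\<lambda>x. f x < g x)"
  using decidable_le[OF computable_Suc, of f g] by (simp add: Suc_le_eq)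

lemma decidable_eq: "computable f \<Longrightarrow> computable g \<Longrightarrow> decidable (\<lambda>x. f x = g x)"
  using decidable_conj[OF decidable_le decidable_le, of f g g f] by (simp add: eq_iff)

lemma decidable_all_less:
  assumes P: "decidable (\<lambda>p. P (p1 p) (p2 p))" and b: "computable b"
  shows "decidable (\<lambda>x. \<forall>i<b x. P i x)"
proof -
  let ?c = "\<lambda>p. if P (p1 p) (p2 p) then 0 else 1 :: nat"
  have c: "computable ?c" using P by (simp add: decidable_def)
  have "computable (\<lambda>p. p1 (p2 p) + ?c (pair (p1 p) (p2 (p2 p))))"
    by (rule computable_add computable_comp[OF c] computable_pair
      computable_p1 computable_p2 computable_id)+
  from computable_rec[OF computable_const[of 0] this b]
  have "computable (\<lambda>x. rec_nat 0 (\<lambda>i y. y + ?c (pair i x)) (b x))" by simp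
  from decidable_zero[OF this]
  have "decidable (\<lambda>x. rec_nat 0 (\<lambda>i y. y + ?c (pair i x)) (b x) = 0)" .
  moreover have "rec_nat 0 (\<lambda>i y. y + ?c (pair i x)) n = 0 \<longleftrightarrow> (\<forall>i<n. P i x)" for n x
    by (induction n) (auto simp: less_Suc_eq)
  ultimately show ?thesis by simp
qed

lemma decidable_ex_less:
  assumes "decidable (\<lambda>p. P (p1 p) (p2 p))" "computable b"
  shows "decidable (\<lambda>x. \<exists>i<b x. P i x)"
proof -
  have "decidable (\<lambda>x. \<not> (\<forall>i<b x. \<not> P i x))"
    by (intro decidable_not decidable_all_less assms)
  then show ?thesis by simp
qed

definition semidecidable :: "(nat \<Rightarrow> bool) \<Rightarrow> bool" where
  "semidecidable P \<longleftrightarrow> (\<exists>D. decidable D \<and> (\<forall>x. P x \<longleftrightarrow> (\<exists>c. D (pair x c))))"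

lemma semidecidable_decidable: "decidable P \<Longrightarrow> semidecidable P"
  unfolding semidecidable_def
  using decidable_comp[OF _ computable_p1[OF computable_id], of P]
  by (intro exI[of _ "\<lambda>p. P (p1 p)"]) simp

lemma semidecidable_comp:
  assumes "semidecidable P" "computable f"
  shows "semidecidable (\<lambda>x. P (f x))"
proof -
  from assms(1) obtain D where D: "decidable D" "\<And>x. P x \<longleftrightarrow> (\<exists>c. D (pair x c))"
    unfolding semidecidable_def by blast
  have "computable (\<lambda>p. pair (f (p1 p)) (p2 p))"
    by (intro computable_pair computable_comp[OF assms(2)] computable_intros)
  from decidable_comp[OF D(1) this] D(2) show ?thesis unfolding semidecidable_def by fastforce
qed

lemma semidecidable_ex:
  assumes "semidecidable (\<lambda>p. P (p1 p) (p2 p))"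
  shows "semidecidable (\<lambda>x. \<exists>y. P x y)"
proof -
  from assms obtain D where D: "decidable D" "\<And>p. P (p1 p) (p2 p) \<longleftrightarrow> (\<exists>c. D (pair p c))"
    unfolding semidecidable_def by blast
  have "P x y \<longleftrightarrow> (\<exists>c. D (pair (pair x y) c))" for x y using D(2)[of "pair x y"] by simp
  then have "(\<exists>y. P x y) \<longleftrightarrow> (\<exists>c. D (pair (pair x (p1 c)) (p2 c)))" for x
    by (metis prod_encode_inverse fst_conv snd_conv)
  moreover have "decidable (\<lambda>q. D (pair (pair (p1 q) (p1 (p2 q))) (p2 (p2 q))))"
    by (rule decidable_comp[OF D(1)]) (intro computable_intros)
  ultimately show ?thesis unfolding semidecidable_def by fastforce
qed

text \<open>The existential over certificates commutes with disjunction: offering the same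
  \<open>c\<close> to both tests replaces dovetailing.\<close>

lemma semidecidable_disj:
  assumes "semidecidable P" "semidecidable Q"
  shows "semidecidable (\<lambda>x. P x \<or> Q x)"
proof -
  from assms obtain D E where D: "decidable D" "\<And>x. P x \<longleftrightarrow> (\<exists>c. D (pair x c))"
    and E: "decidable E" "\<And>x. Q x \<longleftrightarrow> (\<exists>c. E (pair x c))"
    unfolding semidecidable_def by blast
  have "decidable (\<lambda>q. D q \<or> E q)" by (intro decidable_disj D(1) E(1))
  moreover have "P x \<or> Q x \<longleftrightarrow> (\<exists>c. D (pair x c) \<or> E (pair x c))" for x
    unfolding D(2) E(2) by blast
  ultimately show ?thesis unfolding semidecidable_def by blast
qed

text \<open>The search runs over pairs of a value and a certificate with a total test
  \<open>h\<close>. As \<open>f\<close> is a function, whichever pair is found first carries the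
  right value.\<close>

lemma partial_recursive_semidecidable:
  assumes "semidecidable (\<lambda>p. f (p1 p) = Some (p2 p))"
  shows "partial_recursive f"
proof -
  from assms obtain D where D: "decidable D" "\<And>p. f (p1 p) = Some (p2 p) \<longleftrightarrow> (\<exists>c. D (pair p c))"
    unfolding semidecidable_def by blast
  define h where "h c x = (if D (pair (pair x (p1 c)) (p2 c)) then 0 else 1 :: nat)" for c x
  have D': "f x = Some v \<longleftrightarrow> (\<exists>c. D (pair (pair x v) c))" for x v
    using D(2)[of "pair x v"] by simp
  have "computable (\<lambda>q. h (p1 q) (p2 q))"
  proof -
    have "decidable (\<lambda>q. D (pair (pair (p2 q) (p1 (p1 q))) (p2 (p1 q))))"
      by (rule decidable_comp[OF D(1)]) (intro computable_intros)
    then show ?thesis by (simp add: h_def decidable_def)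
  qed
  from computable2_comp[OF this computable2_pair]
    obtain rh where rh: "\<And>c x. eval_recf rh [c, x] (h c x)"
    unfolding computable2_def by auto
  obtain r1 where r1: "\<And>x. eval_recf r1 [x] (p1 x)"
    using computable_p1[OF computable_id] unfolding computable_def by blast
  have h_zero: "f x = Some (p1 c)" if "h c x = 0" for c x
    using that D' by (auto simp: h_def split: if_splits)
  have "f x = Some v \<longleftrightarrow> eval_recf (Comp r1 [Mn rh]) [x] v" for x v
  proof
    assume v: "f x = Some v"
    let ?c = "LEAST c. h c x = 0"
    from v D' obtain w where "D (pair (pair x v) w)" by blast
    then have "h (pair v w) x = 0" by (simp add: h_def)
    then have "\<exists>c. h c x = 0" ..
    then have 0: "h ?c x = 0" by (rule LeastI_ex)
    then have "f x = Some (p1 ?c)" by (rule h_zero)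
    with v have "p1 ?c = v" by simp
    moreover have "eval_recf (Mn rh) [x] ?c"
    proof (rule eval_recf.intros(7))
      show "eval_recf rh [?c, x] 0" using rh 0 by metis
      show "\<forall>i<?c. \<exists>y. eval_recf rh [i, x] (Suc y)"
        using rh not_less_Least by (metis not0_implies_Suc)
    qed
    ultimately show "eval_recf (Comp r1 [Mn rh]) [x] v" using eval_Comp1 r1 by metis
  next
    assume "eval_recf (Comp r1 [Mn rh]) [x] v"
    then obtain c where c: "eval_recf (Mn rh) [x] c" "eval_recf r1 [c] v"
      by (rule eval_CompE) (auto simp: length_Suc_conv)
    from c(1) have "eval_recf rh [c, x] 0" by (rule eval_MnE)
    then have "h c x = 0" using rh eval_recf_determ by metis
    then have "f x = Some (p1 c)" by (rule h_zero)
    moreover have "p1 c = v" using r1 c(2) eval_recf_determ by metis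
    ultimately show "f x = Some v" by simp
  qed
  then show ?thesis unfolding partial_recursive_def by blast
qed

section \<open>Derivability is semidecidable\<close>

text \<open>\<open>R j a b\<close> says that \<open>j\<close> follows from \<open>a\<close> and
  \<open>b\<close>. Keeping \<open>R\<close> abstract justifies the search once, for every
  semidecidable set of rules.\<close>

inductive der :: "(nat \<Rightarrow> nat \<Rightarrow> nat \<Rightarrow> bool) \<Rightarrow> nat \<Rightarrow> bool" for R where
  der_zero: "der R 0"
| der_step: "R j a b \<Longrightarrow> der R a \<Longrightarrow> der R b \<Longrightarrow> der R j"

text \<open>\<open>p2 (y - 1)\<close> is the tail of a coded list and maps the code 0 of the empty
  list to 0, so every read past the end returns 0.\<close>

definition nthc :: "nat \<Rightarrow> nat \<Rightarrow> nat" where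
  "nthc c i = p1 (rec_nat c (\<lambda>_ y. p2 (y - 1)) i - 1)"

lemma prod_decode_0 [simp]: "prod_decode 0 = (0, 0)"
  using prod_encode_inverse[of "(0, 0)"] by (simp add: prod_encode_def)

lemma drop_code:
  "rec_nat (list_encode l) (\<lambda>_ y. p2 (y - 1)) i = list_encode (drop i l)"
proof (induction i)
  case (Suc i)
  then show ?case
    by (cases "drop i l") (simp_all add: drop_Suc[of i] tl_drop[symmetric] flip: drop_Suc)
qed simp

lemma nthc_list_encode: "nthc (list_encode l) i = (if i < length l then l ! i else 0)"
proof (cases "i < length l")
  case True
  then have "drop i l = l ! i # drop (Suc i) l" by (simp add: Cons_nth_drop_Suc)
  with True show ?thesis unfolding nthc_def drop_code by simp
next
  case False
  then show ?thesis unfolding nthc_def drop_code by simp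
qed

lemma length_le_list_encode: "length l \<le> list_encode l"
proof (induction l)
  case (Cons x l)
  also have "list_encode l \<le> pair x (list_encode l)" by (rule le_prod_encode_2)
  finally show ?case by simp
qed simp

lemma computable_nthc: "computable f \<Longrightarrow> computable g \<Longrightarrow> computable (\<lambda>x. nthc (f x) (g x))"
proof -
  assume f: "computable f" and g: "computable g"
  have "computable (\<lambda>p. p2 (p1 (p2 p) - 1))" by (intro computable_intros)
  from computable_rec[OF f this g]
  have "computable (\<lambda>x. rec_nat (f x) (\<lambda>_ y. p2 (y - 1)) (g x))" by simp
  then show ?thesis unfolding nthc_def by (intro computable_intros)
qed

text \<open>A certificate for \<open>der R j\<close> is a list of entries coding \<open>((j, a, b), w)\<close> where \<open>w\<close> witnesses
  \<open>R j a b\<close> and the premises \<open>a\<close>, \<open>b\<close> are conclusions of later entries. Reading beyond the end of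
  the list yields \<open>0\<close>, which as an entry has the trivially derivable conclusion \<open>0\<close>.\<close>

abbreviation concl :: "nat \<Rightarrow> nat" where
  "concl e \<equiv> p1 (p1 e)"

abbreviation premise1 :: "nat \<Rightarrow> nat" where
  "premise1 e \<equiv> p1 (p2 (p1 e))"

abbreviation premise2 :: "nat \<Rightarrow> nat" where
  "premise2 e \<equiv> p2 (p2 (p1 e))"

fun valid_list :: "(nat \<Rightarrow> bool) \<Rightarrow> nat list \<Rightarrow> bool" where
  "valid_list D [] \<longleftrightarrow> True"
| "valid_list D (e # l) \<longleftrightarrow> D e \<and> premise1 e \<in> insert 0 (concl ` set l) \<and>
     premise2 e \<in> insert 0 (concl ` set l) \<and> valid_list D l"

text \<open>A list is no longer than its code, so \<open>c\<close> bounds all positions. The bound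
  \<open>Suc c\<close> for premises admits position \<open>c\<close> itself, which lies past the end
  and offers the conclusion 0.\<close>

definition valid_code :: "(nat \<Rightarrow> bool) \<Rightarrow> nat \<Rightarrow> bool" where
  "valid_code D c \<longleftrightarrow> (\<forall>i<c. nthc c i = 0 \<or> D (nthc c i) \<and>
     (\<exists>k<Suc c. i < k \<and> concl (nthc c k) = premise1 (nthc c i)) \<and>
     (\<exists>k<Suc c. i < k \<and> concl (nthc c k) = premise2 (nthc c i)))"

lemma valid_list_append: "valid_list D l \<Longrightarrow> valid_list D m \<Longrightarrow> valid_list D (l @ m)"
  by (induction l) auto

lemma valid_list_nth:
  "valid_list D l \<Longrightarrow> i < length l \<Longrightarrow> D (l ! i) \<and>
     premise1 (l ! i) \<in> insert 0 (concl ` set (drop (Suc i) l)) \<and>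
     premise2 (l ! i) \<in> insert 0 (concl ` set (drop (Suc i) l))"
proof (induction l arbitrary: i)
  case (Cons e l)
  then show ?case by (cases i) simp_all
qed simp

lemma concl_later:
  assumes "x \<in> insert 0 (concl ` set (drop (Suc i) l))" "i < length l"
  shows "\<exists>k<Suc (list_encode l). i < k \<and> concl (nthc (list_encode l) k) = x"
proof (cases "x = 0")
  case True
  with assms(2) show ?thesis using length_le_list_encode[of l]
    by (intro exI[of _ "list_encode l"]) (simp add: nthc_list_encode)
next
  case False
  with assms(1) obtain k where k: "k < length l - Suc i" and x: "x = concl (l ! (Suc i + k))"
    by (auto simp: in_set_conv_nth)
  from k have "Suc i + k < length l" by simp
  with x show ?thesis using length_le_list_encode[of l]
    by (intro exI[of _ "Suc i + k"]) (simp add: nthc_list_encode)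
qed

lemma valid_list_encode: "valid_list D l \<Longrightarrow> valid_code D (list_encode l)"
  unfolding valid_code_def
proof (intro allI impI)
  fix i
  let ?n = "nthc (list_encode l)"
  assume v: "valid_list D l"
  show "?n i = 0 \<or> D (?n i) \<and>
     (\<exists>k<Suc (list_encode l). i < k \<and> concl (?n k) = premise1 (?n i)) \<and>
     (\<exists>k<Suc (list_encode l). i < k \<and> concl (?n k) = premise2 (?n i))"
  proof (cases "i < length l")
    case True
    have "?n i = l ! i" using True by (simp add: nthc_list_encode)
    with valid_list_nth[OF v True] concl_later[OF _ True] show ?thesis by simp
  qed (simp add: nthc_list_encode)
qed

text \<open>Premises are found only at later positions, so induction on \<open>c - i\<close>
  excludes circular justifications.\<close>

lemma valid_code_sound:
  assumes D: "\<And>e. D e \<Longrightarrow> R (concl e) (premise1 e) (premise2 e)" and v: "valid_code D c"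
  shows "der R (concl (nthc c i))"
proof (induction "c - i" arbitrary: i rule: less_induct)
  case less
  let ?e = "nthc c i"
  have later: "der R x" if "\<exists>k<Suc c. i < k \<and> concl (nthc c k) = x" "i < c" for x
  proof -
    from that obtain k where k: "i < k" "concl (nthc c k) = x" by blast
    with that(2) less[of k] show ?thesis by simp
  qed
  consider "?e = 0" | "i < c" "D ?e" "\<exists>k<Suc c. i < k \<and> concl (nthc c k) = premise1 ?e"
    "\<exists>k<Suc c. i < k \<and> concl (nthc c k) = premise2 ?e"
  proof (cases "i < c")
    case False
    have "length (list_decode c) \<le> i"
      using length_le_list_encode[of "list_decode c"] False by simp
    then have "?e = 0" using nthc_list_encode[of "list_decode c" i] by simp
    with that show thesis by blast
  next
    case True
    with v have e: "?e = 0 \<or> D ?e \<and> (\<exists>k<Suc c. i < k \<and> concl (nthc c k) = premise1 ?e) \<and>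
      (\<exists>k<Suc c. i < k \<and> concl (nthc c k) = premise2 ?e)"
      unfolding valid_code_def by blast
    show thesis
    proof (cases "?e = 0")
      case False
      with e have "D ?e" "\<exists>k<Suc c. i < k \<and> concl (nthc c k) = premise1 ?e"
        "\<exists>k<Suc c. i < k \<and> concl (nthc c k) = premise2 ?e" by simp_all
      with True show thesis by (rule that(2))
    qed (rule that(1))
  qed
  then show ?case
  proof cases
    case 1
    then show ?thesis by (simp add: der_zero)
  next
    case 2
    then show ?thesis using der_step[of R, OF D] later by blast
  qed
qed

text \<open>The new entry is put in front of the concatenated certificates of its premises; the
  empty list certifies 0.\<close>

lemma der_valid_list:
  assumes D: "\<And>j a b. R j a b \<Longrightarrow> \<exists>e. D e \<and> concl e = j \<and> premise1 e = a \<and> premise2 e = b"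
    and "der R j"
  shows "\<exists>l. valid_list D l \<and> (case l of [] \<Rightarrow> j = 0 | e # _ \<Rightarrow> concl e = j)"
  using assms(2)
proof (induction rule: der.induct)
  case der_zero
  show ?case by (intro exI[of _ "[]"]) simp
next
  case (der_step j a b)
  then obtain l m where l: "valid_list D l" "case l of [] \<Rightarrow> a = 0 | e # _ \<Rightarrow> concl e = a"
    and m: "valid_list D m" "case m of [] \<Rightarrow> b = 0 | e # _ \<Rightarrow> concl e = b" by blast
  from D[OF der_step(1)] obtain e
    where e: "D e" "concl e = j" "premise1 e = a" "premise2 e = b" by blast
  have "a \<in> insert 0 (concl ` set (l @ m))" using l(2) by (auto split: list.splits)
  moreover have "b \<in> insert 0 (concl ` set (l @ m))" using m(2) by (auto split: list.splits)
  ultimately have "valid_list D (e # l @ m)"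
    using e valid_list_append[OF l(1) m(1)] by simp
  with e(2) show ?case by (intro exI[of _ "e # l @ m"]) simp
qed

lemma semidecidable_der:
  assumes "semidecidable (\<lambda>x. R (p1 x) (p1 (p2 x)) (p2 (p2 x)))"
  shows "semidecidable (der R)"
proof -
  from assms obtain D where D: "decidable D"
    "\<And>x. R (p1 x) (p1 (p2 x)) (p2 (p2 x)) \<longleftrightarrow> (\<exists>c. D (pair x c))"
    unfolding semidecidable_def by blast
  have sound: "R (concl e) (premise1 e) (premise2 e)" if "D e" for e
    using D(2)[of "p1 e"] that by (metis prod.collapse prod_decode_inverse)
  have complete: "\<exists>e. D e \<and> concl e = j \<and> premise1 e = a \<and> premise2 e = b" if "R j a b" for j a b
  proof -
    from that D(2)[of "pair j (pair a b)"] obtain w where "D (pair (pair j (pair a b)) w)" by auto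
    then show ?thesis by (intro exI[of _ "pair (pair j (pair a b)) w"]) simp
  qed
  have "der R j \<longleftrightarrow> (\<exists>c. valid_code D c \<and> concl (nthc c 0) = j)" for j
  proof
    assume "der R j"
    from der_valid_list[OF complete this] obtain l
      where l: "valid_list D l" "case l of [] \<Rightarrow> j = 0 | e # _ \<Rightarrow> concl e = j" by blast
    then have "concl (nthc (list_encode l) 0) = j"
      by (auto simp: nthc_list_encode split: list.splits)
    with l(1) show "\<exists>c. valid_code D c \<and> concl (nthc c 0) = j"
      using valid_list_encode by blast
  next
    assume "\<exists>c. valid_code D c \<and> concl (nthc c 0) = j"
    then show "der R j" using valid_code_sound[of D R, OF sound] by blast
  qed
  moreover have "decidable (valid_code D)"
    unfolding valid_code_def[abs_def]
    by (rule decidable_all_less decidable_ex_less decidable_disj decidable_conj decidable_eq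
        decidable_less decidable_comp[OF D(1)] computable_nthc computable_intros)+
  then have "decidable (\<lambda>q. valid_code D (p2 q))" by (rule decidable_comp) (intro computable_intros)
  then have "decidable (\<lambda>q. valid_code D (p2 q) \<and> concl (nthc (p2 q) 0) = p1 q)"
    by (rule decidable_conj) (intro decidable_eq computable_nthc computable_intros)
  ultimately show ?thesis
    unfolding semidecidable_def
      by (intro exI[of _ "\<lambda>q. valid_code D (p2 q) \<and> concl (nthc (p2 q) 0) = p1 q"]) simp
qed

section \<open>Boehm trees are recursive\<close>

text \<open>A bijection between terms and numbers that sorts the constructors by residues modulo 4.\<close>

primrec enc :: "dB \<Rightarrow> nat" where
  "enc (Var i) = i + i"
| "enc (App s t) = Suc (pair (enc s) (enc t) + pair (enc s) (enc t)
  + (pair (enc s) (enc t) + pair (enc s) (enc t)))"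
| "enc (Abs s) = Suc (Suc (Suc (enc s + enc s + (enc s + enc s))))"

lemma enc_eq_iff [simp]: "enc s = enc t \<longleftrightarrow> s = t"
proof
  show "enc s = enc t \<Longrightarrow> s = t"
  proof (induction s arbitrary: t)
    case (Var i)
    then show ?case by (cases t) (simp_all, presburger+)
  next
    case (App s1 s2)
    then show ?case
    proof (cases t)
      case (App t1 t2)
      with App.prems have "pair (enc s1) (enc s2) = pair (enc t1) (enc t2)"
        by (simp del: prod_encode_eq)
      with App App.IH show ?thesis by simp
    qed (simp_all, presburger+)
  next
    case (Abs s)
    then show ?case
    proof (cases t)
      case (Abs u)
      with Abs.prems have "enc s = enc u" by simp
      with Abs \<open>\<And>t. enc s = enc t \<Longrightarrow> s = t\<close> show ?thesis by blast
    qed (simp_all, presburger+)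
  qed
qed simp

lemma enc_surj: "\<exists>t. enc t = n"
proof (induction n rule: less_induct)
  case (less n)
  consider i where "n = i + i" | p where "n = Suc (p + p + (p + p))"
    | p where "n = Suc (Suc (Suc (p + p + (p + p))))"
  proof -
    have "(\<exists>i. n = i + i) \<or> (\<exists>p. n = Suc (p + p + (p + p)))
      \<or> (\<exists>p. n = Suc (Suc (Suc (p + p + (p + p)))))"
      by presburger
    with that show thesis by blast
  qed
  then show ?case
  proof cases
    case 1
    then show ?thesis by (intro exI[of _ "Var i" for i]) simp
  next
    case 2
    obtain a b where p: "p = pair a b" by (metis prod_decode_inverse surj_pair)
    have "a \<le> p" "b \<le> p" by (simp_all add: p le_prod_encode_1 le_prod_encode_2)
    with 2 less[of a] less[of b] obtain s t where "enc s = a" "enc t = b" by auto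
    then show ?thesis using 2 p by (intro exI[of _ "App s t"]) simp
  next
    case 3
    with less[of p] obtain s where "enc s = p" by auto
    then show ?thesis using 3 by (intro exI[of _ "Abs s"]) simp
  qed
qed

definition den :: "nat \<Rightarrow> dB" where
  "den = inv enc"

lemma enc_den [simp]: "enc (den n) = n"
  unfolding den_def by (rule f_inv_into_f) (use enc_surj in \<open>metis rangeI\<close>)

lemma den_enc [simp]: "den (enc t) = t"
  using enc_den[of "enc t"] unfolding enc_eq_iff .

lemma semidecidable_ex_term:
  assumes "semidecidable (\<lambda>p. P (p1 p) (den (p2 p)))"
  shows "semidecidable (\<lambda>x. \<exists>t. P x t)"
proof -
  have "semidecidable (\<lambda>x. \<exists>n. P x (den n))" using assms by (rule semidecidable_ex)
  moreover have "(\<exists>n. P x (den n)) \<longleftrightarrow> (\<exists>t. P x t)" for x by (metis den_enc)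
  ultimately show ?thesis by simp
qed

text \<open>The codes use only successors, sums and pairs, which is why multiples of four are
  written as sums. From here on the codes stay opaque.\<close>

lemma computable_enc:
  "computable f \<Longrightarrow> computable (\<lambda>x. enc (den (f x)))"
  "computable f \<Longrightarrow> computable (\<lambda>x. enc (Var (f x)))"
  "computable (\<lambda>x. enc (s x)) \<Longrightarrow> computable (\<lambda>x. enc (Abs (s x)))"
  "computable (\<lambda>x. enc (s x)) \<Longrightarrow> computable (\<lambda>x. enc (t x)) \<Longrightarrow> computable (\<lambda>x. enc (App (s x) (t x)))"
  by (simp_all add: computable_intros)

declare enc.simps [simp del]

text \<open>All tags are literals of the form \<open>numeral n\<close>, so that
  \<open>pair_neq_0\<close> separates judgments from the trivial code 0; a tag 1 would not match
  that pattern.\<close>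

abbreviation jLift :: "dB \<Rightarrow> nat \<Rightarrow> dB \<Rightarrow> nat" where
  "jLift s k t \<equiv> pair 9 (pair (enc s) (pair k (enc t)))"

abbreviation jSubst :: "dB \<Rightarrow> dB \<Rightarrow> nat \<Rightarrow> dB \<Rightarrow> nat" where
  "jSubst s u k t \<equiv> pair 2 (pair (enc s) (pair (enc u) (pair k (enc t))))"

abbreviation jBeta :: "dB \<Rightarrow> dB \<Rightarrow> nat" where
  "jBeta s t \<equiv> pair 3 (pair (enc s) (enc t))"

abbreviation jReds :: "dB \<Rightarrow> dB \<Rightarrow> nat" where
  "jReds s t \<equiv> pair 4 (pair (enc s) (enc t))"

abbreviation jSpine :: "dB \<Rightarrow> nat \<Rightarrow> nat" where
  "jSpine s n \<equiv> pair 5 (pair (enc s) n)"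

abbreviation jArg :: "dB \<Rightarrow> nat \<Rightarrow> dB \<Rightarrow> nat" where
  "jArg s i t \<equiv> pair 6 (pair (enc s) (pair i (enc t)))"

abbreviation jHnf :: "dB \<Rightarrow> nat \<Rightarrow> nat \<Rightarrow> nat" where
  "jHnf s c k \<equiv> pair 7 (pair (enc s) (pair c k))"

abbreviation jTree :: "dB \<Rightarrow> nat \<Rightarrow> nat \<Rightarrow> nat" where
  "jTree s c k \<equiv> pair 8 (pair (enc s) (pair c k))"

text \<open>Every rule has two premises; \<open>0\<close> is the code of a trivial judgment and fills unused places.\<close>

inductive bt_rule :: "nat \<Rightarrow> nat \<Rightarrow> nat \<Rightarrow> bool" where
  "i < k \<Longrightarrow> bt_rule (jLift (Var i) k (Var i)) 0 0"
| "k \<le> i \<Longrightarrow> bt_rule (jLift (Var i) k (Var (Suc i))) 0 0"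
| "bt_rule (jLift (App s t) k (App s' t')) (jLift s k s') (jLift t k t')"
| "bt_rule (jLift (Abs s) k (Abs s')) (jLift s (Suc k) s') 0"
| "k < i \<Longrightarrow> bt_rule (jSubst (Var i) u k (Var (i - 1))) 0 0"
| "bt_rule (jSubst (Var k) u k u) 0 0"
| "i < k \<Longrightarrow> bt_rule (jSubst (Var i) u k (Var i)) 0 0"
| "bt_rule (jSubst (App s t) u k (App s' t')) (jSubst s u k s') (jSubst t u k t')"
| "bt_rule (jSubst (Abs s) u k (Abs s')) (jLift u 0 u') (jSubst s u' (Suc k) s')"
| "bt_rule (jBeta (App (Abs s) t) u) (jSubst s t 0 u) 0"
| "bt_rule (jBeta (App s u) (App t u)) (jBeta s t) 0"
| "bt_rule (jBeta (App u s) (App u t)) (jBeta s t) 0"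
| "bt_rule (jBeta (Abs s) (Abs t)) (jBeta s t) 0"
| "bt_rule (jReds s s) 0 0"
| "bt_rule (jReds s u) (jBeta s t) (jReds t u)"
| "bt_rule (jSpine (Var y) 0) 0 0"
| "bt_rule (jSpine (App s t) (Suc n)) (jSpine s n) 0"
| "bt_rule (jArg (App s t) n t) (jSpine s n) 0"
| "bt_rule (jArg (App s t) i u) (jArg s i u) 0"
| "bt_rule (jHnf s 0 k) (jSpine s k) 0"
| "bt_rule (jHnf s (Suc (pair i c)) k) (jArg s i t) (jTree t c k)"
| "bt_rule (jHnf (Abs s) c k) (jHnf s c k) 0"
| "bt_rule (jTree s c k) (jReds s t) (jHnf t c k)"

text \<open>Unfolded, a rule application is a disjunction of existential statements over equations
  between codes and comparisons; quantifiers over terms go through the bijection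
  \<open>den\<close>.\<close>

lemma semidecidable_bt_rule: "semidecidable (\<lambda>x. bt_rule (p1 x) (p1 (p2 x)) (p2 (p2 x)))"
  unfolding bt_rule.simps
  by (intro semidecidable_disj semidecidable_ex_term semidecidable_ex semidecidable_decidable
    decidable_conj decidable_eq decidable_less
      decidable_le computable_enc computable_intros)

section \<open>Soundness of the rules for Boehm trees\<close>

definition spine_child :: "dB list \<Rightarrow> nat list \<Rightarrow> nat \<Rightarrow> bool" where
  "spine_child as \<sigma> k \<longleftrightarrow> (case \<sigma> of [] \<Rightarrow> k = length as
     | i # \<tau> \<Rightarrow> i < length as \<and> underlying_tree (BT (as ! i)) \<tau> = Some k)"

lemma underlying_tree_hnf:
  "beta_reds s (abss n (apps (Var y) as)) \<Longrightarrow>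
     underlying_tree (BT s) \<sigma> = Some k \<longleftrightarrow> spine_child as \<sigma> k"
  by (cases \<sigma>) (auto simp: BT_reds underlying_tree_def BT_hnf spine_child_def)

text \<open>Stated by implications, so that a number coding no judgment, in particular 0, satisfies
  it vacuously.\<close>

definition bt_judgment :: "nat \<Rightarrow> bool" where
  "bt_judgment j \<longleftrightarrow>
     (\<forall>s k t. j = jLift s k t \<longrightarrow> lift s k = t) \<and>
     (\<forall>s u k t. j = jSubst s u k t \<longrightarrow> subst s u k = t) \<and>
     (\<forall>s t. j = jBeta s t \<longrightarrow> beta s t) \<and>
     (\<forall>s t. j = jReds s t \<longrightarrow> beta_reds s t) \<and>
     (\<forall>s n. j = jSpine s n \<longrightarrow> (\<exists>y as. s = apps (Var y) as \<and> length as = n)) \<and>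
     (\<forall>s i t. j = jArg s i t \<longrightarrow> (\<exists>y as. s = apps (Var y) as \<and> i < length as \<and> as ! i = t)) \<and>
     (\<forall>s c k. j = jHnf s c k \<longrightarrow>
        (\<exists>n y as. s = abss n (apps (Var y) as) \<and> spine_child as (list_decode c) k)) \<and>
     (\<forall>s c k. j = jTree s c k \<longrightarrow> underlying_tree (BT s) (list_decode c) = Some k)"

lemma pair_neq_0 [simp]: "0 \<noteq> pair (numeral n) x"
  using le_prod_encode_1[of "numeral n" x] by (metis not_numeral_le_zero)

lemma bt_judgment_rule:
  assumes "bt_rule j a b" "bt_judgment a" "bt_judgment b"
  shows "bt_judgment j"
  using assms
proof (induction rule: bt_rule.induct)
  case (15 s u t)
  then have "beta s t" "beta_reds t u" by (simp_all add: bt_judgment_def)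
  then have "beta_reds s u" by (rule converse_rtranclp_into_rtranclp)
  then show ?case by (simp add: bt_judgment_def)
next
  case (16 y)
  have "Var y = apps (Var y) [] \<and> length ([] :: dB list) = 0" by simp
  then show ?case unfolding bt_judgment_def by (simp del: apps_simps) blast
next
  case (17 s t n)
  then obtain y as where "s = apps (Var y) as" "length as = n" by (auto simp: bt_judgment_def)
  then have "App s t = apps (Var y) (as @ [t]) \<and> length (as @ [t]) = Suc n" by simp
  then show ?case unfolding bt_judgment_def by (simp del: apps_simps)
next
  case (18 s t n)
  then obtain y as where "s = apps (Var y) as" "length as = n" by (auto simp: bt_judgment_def)
  then have "App s t = apps (Var y) (as @ [t]) \<and> n < length (as @ [t]) \<and> (as @ [t]) ! n = t" by auto
  then show ?case unfolding bt_judgment_def by (simp del: apps_simps)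
next
  case (19 s t i u)
  then obtain y as where "s = apps (Var y) as" "i < length as" "as ! i = u"
    by (auto simp: bt_judgment_def)
  then have "App s t = apps (Var y) (as @ [t]) \<and> i < length (as @ [t]) \<and> (as @ [t]) ! i = u"
    by (auto simp: nth_append)
  then show ?case unfolding bt_judgment_def by (simp del: apps_simps)
next
  case (20 s k)
  then obtain y as where "s = apps (Var y) as" "length as = k" by (auto simp: bt_judgment_def)
  then have "s = abss 0 (apps (Var y) as) \<and> spine_child as (list_decode 0) k"
    by (simp add: spine_child_def)
  then show ?case unfolding bt_judgment_def by (simp del: abss_simps)
next
  case (21 s i c k t)
  then obtain y as where "s = apps (Var y) as" "i < length as" "as ! i = t"
    by (auto simp: bt_judgment_def)
  moreover from 21 have "underlying_tree (BT t) (list_decode c) = Some k"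
    by (simp add: bt_judgment_def)
  ultimately have "s = abss 0 (apps (Var y) as) \<and> spine_child as (list_decode (Suc (pair i c))) k"
    by (simp add: spine_child_def)
  then show ?case unfolding bt_judgment_def by (simp del: abss_simps list_decode.simps)
next
  case (22 s c k)
  then obtain n y as where "s = abss n (apps (Var y) as)" "spine_child as (list_decode c) k"
    by (auto simp: bt_judgment_def)
  then have "Abs s = abss (Suc n) (apps (Var y) as) \<and> spine_child as (list_decode c) k" by simp
  then show ?case unfolding bt_judgment_def by (simp del: abss_simps)
next
  case (23 s c k t)
  then obtain n y as where "beta_reds s t" "t = abss n (apps (Var y) as)"
    "spine_child as (list_decode c) k"
    by (auto simp: bt_judgment_def)
  then show ?case by (simp add: bt_judgment_def underlying_tree_hnf)
qed (auto simp: bt_judgment_def intro: beta.intros)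

lemma bt_judgment_der: "der bt_rule j \<Longrightarrow> bt_judgment j"
  by (induction rule: der.induct) (simp add: bt_judgment_def, rule bt_judgment_rule)

section \<open>Completeness of the rules\<close>

abbreviation bt_der :: "nat \<Rightarrow> bool" where
  "bt_der \<equiv> der bt_rule"

lemma der_lift: "bt_der (jLift s k (lift s k))"
proof (induction s arbitrary: k)
  case (Var i)
  show ?case
  proof (cases "i < k")
    case True
    from der_step[of bt_rule, OF bt_rule.intros(1)[OF this] der_zero der_zero] True
    show ?thesis by simp
  next
    case False
    then have "k \<le> i" by simp
    from der_step[of bt_rule, OF bt_rule.intros(2)[OF this] der_zero der_zero] False
    show ?thesis by simp
  qed
next
  case (App s t)
  from der_step[of bt_rule, OF bt_rule.intros(3) App] show ?case by simp
next
  case (Abs s)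
  from der_step[of bt_rule, OF bt_rule.intros(4) Abs der_zero] show ?case by simp
qed

lemma der_subst: "bt_der (jSubst s u k (subst s u k))"
proof (induction s arbitrary: u k)
  case (Var i)
  consider "k < i" | "i = k" | "i < k" by linarith
  then show ?case
  proof cases
    case 1
    from der_step[of bt_rule, OF bt_rule.intros(5)[OF 1] der_zero der_zero] 1
    show ?thesis by simp
  next
    case 2
    from der_step[of bt_rule, OF bt_rule.intros(6) der_zero der_zero] 2
    show ?thesis by simp
  next
    case 3
    from der_step[of bt_rule, OF bt_rule.intros(7)[OF 3] der_zero der_zero] 3
    show ?thesis by simp
  qed
next
  case (App s t)
  from der_step[of bt_rule, OF bt_rule.intros(8) App] show ?case by simp
next
  case (Abs s)
  from der_step[of bt_rule, OF bt_rule.intros(9) der_lift Abs] show ?case by simp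
qed

lemma der_beta: "beta s t \<Longrightarrow> bt_der (jBeta s t)"
proof (induction rule: beta.induct)
  case (beta_redex s t)
  from der_step[of bt_rule, OF bt_rule.intros(10) der_subst der_zero] show ?case .
next
  case (appL s t u)
  from der_step[of bt_rule, OF bt_rule.intros(11) appL.IH der_zero] show ?case .
next
  case (appR s t u)
  from der_step[of bt_rule, OF bt_rule.intros(12) appR.IH der_zero] show ?case .
next
  case (abs s t)
  from der_step[of bt_rule, OF bt_rule.intros(13) abs.IH der_zero] show ?case .
qed

lemma der_reds: "beta_reds s t \<Longrightarrow> bt_der (jReds s t)"
proof (induction rule: converse_rtranclp_induct)
  case base
  from der_step[of bt_rule, OF bt_rule.intros(14) der_zero der_zero] show ?case .
next
  case (step s u)
  from der_step[of bt_rule, OF bt_rule.intros(15) der_beta[OF step.hyps(1)] step.IH] show ?case .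
qed

lemma der_spine: "bt_der (jSpine (apps (Var y) as) (length as))"
proof (induction as rule: rev_induct)
  case Nil
  from der_step[of bt_rule, OF bt_rule.intros(16) der_zero der_zero] show ?case by simp
next
  case (snoc a as)
  from der_step[of bt_rule, OF bt_rule.intros(17) snoc der_zero] show ?case by simp
qed

lemma der_arg: "i < length as \<Longrightarrow> bt_der (jArg (apps (Var y) as) i (as ! i))"
proof (induction as rule: rev_induct)
  case (snoc a as)
  show ?case
  proof (cases "i < length as")
    case True
    from der_step[of bt_rule, OF bt_rule.intros(19) snoc.IH[OF True] der_zero] True
    show ?thesis by (simp add: nth_append)
  next
    case False
    with snoc.prems have "i = length as" by simp
    with der_step[of bt_rule, OF bt_rule.intros(18) der_spine der_zero] show ?thesis by simp
  qed
qed simp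

lemma der_hnf: "bt_der (jHnf (apps (Var y) as) c k) \<Longrightarrow> bt_der (jHnf (abss n (apps (Var y) as)) c k)"
proof (induction n)
  case (Suc n)
  from der_step[of bt_rule, OF bt_rule.intros(22) Suc.IH[OF Suc.prems] der_zero]
  show ?case by simp
qed simp

text \<open>By \<open>underlying_tree_hnf\<close> the label may be read off any head normal form, so
  a derivation can use whichever reduction is given and descend into the argument on the
  path.\<close>

lemma der_tree: "underlying_tree (BT s) \<sigma> = Some k \<Longrightarrow> bt_der (jTree s (list_encode \<sigma>) k)"
proof (induction \<sigma> arbitrary: s)
  case Nil
  then obtain n y as where r: "beta_reds s (abss n (apps (Var y) as))"
    by (cases rule: BT_cases[of s]) (auto simp: underlying_tree_def bt_bot_def)
  with Nil have k: "length as = k" by (simp add: underlying_tree_hnf spine_child_def)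
  from der_spine[of y as] have "bt_der (jSpine (apps (Var y) as) k)" unfolding k .
  from der_step[of bt_rule, OF bt_rule.intros(20) this der_zero]
  have "bt_der (jHnf (apps (Var y) as) 0 k)" .
  from der_step[of bt_rule, OF bt_rule.intros(23) der_reds[OF r] der_hnf[OF this]]
  show ?case by simp
next
  case (Cons i \<sigma>)
  then obtain n y as where r: "beta_reds s (abss n (apps (Var y) as))"
    by (cases rule: BT_cases[of s]) (auto simp: underlying_tree_def bt_bot_def)
  with Cons.prems have k: "i < length as" "underlying_tree (BT (as ! i)) \<sigma> = Some k"
    by (simp_all add: underlying_tree_hnf spine_child_def)
  from der_step[of bt_rule, OF bt_rule.intros(21) der_arg[OF k(1)] Cons.IH[OF k(2)]]
  have "bt_der (jHnf (apps (Var y) as) (Suc (pair i (list_encode \<sigma>))) k)" .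
  from der_step[of bt_rule, OF bt_rule.intros(23) der_reds[OF r] der_hnf[OF this]]
  show ?case by simp
qed

lemma partial_recursive_BT: "partial_recursive (\<lambda>c. underlying_tree (BT Q) (list_decode c))"
proof (rule partial_recursive_semidecidable)
  have "underlying_tree (BT Q) (list_decode c) = Some k \<longleftrightarrow> bt_der (jTree Q c k)" for c k
    using bt_judgment_der[of "jTree Q c k"] der_tree[of Q "list_decode c" k]
    by (auto simp: bt_judgment_def)
  moreover have "semidecidable (\<lambda>p. bt_der (jTree Q (p1 p) (p2 p)))"
    by (rule semidecidable_comp[OF semidecidable_der[OF semidecidable_bt_rule]])
      (intro computable_intros)
  ultimately show "semidecidable (\<lambda>p. underlying_tree (BT Q) (list_decode (p1 p)) = Some (p2 p))"
    by simp
qed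

theorem mainTheorem5:
  shows "(\<forall>Q\<in>E_omega. recursive_tree (underlying_tree (BT Q)))
       \<and> (\<forall>Q\<in>E_omega. \<forall>Q'\<in>E_omega.
            underlying_tree (BT Q) = underlying_tree (BT Q') \<longleftrightarrow> Q =\<^sub>B Q')
       \<and> (\<forall>T. recursive_tree T \<longrightarrow>
            (\<exists>J. closed J \<and> J \<in> E_omega \<and> underlying_tree (BT J) = T))"
proof (intro conjI ballI allI impI)
  fix Q assume "Q \<in> E_omega"
  then show "recursive_tree (underlying_tree (BT Q))"
    unfolding recursive_tree_def E_omega_def
    using is_tree_eta[where U = "BT (Abs (Var 0))", OF _ BT_id_root] partial_recursive_BT by blast
next
  fix Q Q' assume "Q \<in> E_omega" "Q' \<in> E_omega"
  then show "underlying_tree (BT Q) = underlying_tree (BT Q') \<longleftrightarrow> Q =\<^sub>B Q'"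
    unfolding E_omega_def beq_def
      using eta_le_determined[where U = "BT (Abs (Var 0))", OF _ _ BT_id_root] by auto
next
  fix T assume T: "recursive_tree T"
  then obtain r where r: "\<And>x v. T (list_decode x) = Some v \<longleftrightarrow> eval_recf r [x] v"
    unfolding recursive_tree_def partial_recursive_def by blast
  have "T \<sigma> = Some m \<longleftrightarrow> eval_recf r [list_encode \<sigma>] m" for \<sigma> m
    using r[of "list_encode \<sigma>"] by simp
  \<comment> \<open>The program for cons on list codes, by which a node passes to its
    children.\<close>
  moreover obtain s where "\<And>x y. eval_recf s [x, y] (Suc (pair x y))"
    using computable2_comp[OF computable_Suc[OF computable_id] computable2_pair]
      unfolding computable2_def by blast
  ultimately have "expansionT s r \<in> E_omega" "underlying_tree (BT (expansionT s r)) = T"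
    using T expansionT_correct[of T r s] by (auto simp: recursive_tree_def E_omega_def)
  then show "\<exists>J. closed J \<and> J \<in> E_omega \<and> underlying_tree (BT J) = T"
    using closed_expansions(5) by blast
qed

end
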